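(* Let $q=2$, $\ell>1$, $d<\ell$, and suppose $m:=\ell-d+2$ divides $\ell$. With $s=1$ and $r=3$, the construction described in the context provides a code ${\rm RS}(\mathcal{A},2^d-3)$ over $\mathbb{F}_{2^\ell}$, where $\mathcal{A}$ is a $d$-dimensional $\mathbb{F}_2$-subspace of $\mathbb{F}_{2^\ell}$, and a corresponding linear repair scheme. With $n=2^d$, the I/O cost of that linear repair scheme (with respect to the basis $\mathcal{B}$ of the construction) is $$(n-1)\ell-(\ell-d+2)2^{d-1},$$ which is optimal, i.e. no linear repair scheme over $\mathbb{F}_2$ for ${\rm RS}(\mathcal{A},2^d-3)$ has a smaller I/O cost with respect to any basis.
   Context: General definitions. Let $B=\mathbb{F}_2$, $F=\mathbb{F}_{2^\ell}$, ${\rm Tr}_{F/B}$ the trace, $K={\rm Ker}({\rm Tr}_{F/B})$. For $\mathcal{A}=\{\alpha_1,\dots,\alpha_n\}\subseteq F$ and $1\le k<n$, ${\rm RS}(\mathcal{A},k)=\{(f(\alpha_1),\dots,f(\alpha_n)): f\in F[x],\ \deg f\le k-1\}$; coordinate $i$ is called node $i$, and "node $0$" means the coordinate with evaluation point $0$. When $\mathcal{A}$ is a $B$-linear subspace of $F$, ${\rm RS}(\mathcal{A},k)^\perp={\rm RS}(\mathcal{A},n-k)$. A linear repair scheme (over $B$) for node $i^*$ of ${\rm RS}(\mathcal{A},k)$ is a list of $\ell$ polynomials $g_1,\dots,g_\ell\in F[x]$ of degree less than $n-k$ such that $g_1(\alpha_{i^*}),\dots,g_\ell(\alpha_{i^*})$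 are linearly independent over $B$. Given a basis $\mathcal{B}=\{\beta^{(1)},\dots,\beta^{(\ell)}\}$ of $F$ over $B$, let $W_i$ be the $\ell\times\ell$ matrix over $B$ whose $(j,\nu)$ entry is ${\rm Tr}_{F/B}(g_j(\alpha_i)\beta^{(\nu)})$. The I/O cost with respect to $\mathcal{B}$ is $\gamma_{I/O}=\sum_{i=1}^n{\rm nz}(W_i)-\ell=\sum_{i\ne i^*}{\rm nz}(W_i)$, where ${\rm nz}(W)$ is the number of nonzero columns of $W$. Construction (written for $q=2$, $s=1$, $r=3$, $m=\ell-d+2$). (1) Let $\{\gamma^{(1)}=1,\gamma^{(2)},\dots,\gamma^{(m)}\}$ be a basis of $\mathbb{F}_{2^m}$ over $B$ and $\{\lambda_1=1,\lambda_2,\dots,\lambda_{\ell/m}\}$ a basis of $F$ over $\mathbb{F}_{2^m}$. Set $\gamma^{((i-1)m+j)}=\lambda_i\gamma^{(j)}$ for $1\le i\le\ell/m$, $1\le j\le m$; then $\{\gamma^{(1)},\dots,\gamma^{(\ell)}\}$ is a basis of $F$ over $B$. Let $\mathcal{B}=\{\beta^{(1)},\dots,\beta^{(\ell)}\}$ be its dual basis, i.e. ${\rm Tr}_{F/B}(\beta^{(i)}\gamma^{(j)})=1$ if $i=j$ and $0$ otherwise. (2) Let $L(x)=\theta_0x+\theta_1x^2\in F[x]$ with $\theta_1\ne0$ be such that $L(F)=(\beta^{(2)})^{-1}K$ (such $L$ exists). Let $W=\bigcap_{i=2}^{\ell-d+2}(\beta^{(i)})^{-1}K$ and $\mathcal{A}=L^{-1}(W)=\{x\in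 F:L(x)\in W\}$, a $d$-dimensional $B$-subspace of $F$. (3) The repair scheme for node $0$ is $g_j(x)=\gamma^{(j)}L(x)+\gamma^{(j)}$ for $1\le j\le m$ and $g_j(x)=\gamma^{(j)}$ for $m+1\le j\le\ell$. *)

theory Defs
  imports "HOL-Computational_Algebra.Polynomial"
begin

(* The field F is a type 'a with 2^l elements; its subfields are sets, so that linear algebra
   over F_2 and over an intermediate field F_(2^m) can be stated in the same way.
   Families v(1), ..., v(n) are functions on nat of which only the values at 1..n matter. *)

definition prime_field2 :: "'a::field set" where
  "prime_field2 = {0, 1}"

definition is_subfield :: "'a::field set \<Rightarrow> bool" where
  "is_subfield E \<longleftrightarrow> 0 \<in> E \<and> 1 \<in> E \<and> (\<forall>x\<in>E. \<forall>y\<in>E. x + y \<in> E \<and> x * y \<in> E) \<and>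
     (\<forall>x\<in>E. - x \<in> E \<and> inverse x \<in> E)"

definition subspace_over :: "'a::field set \<Rightarrow> 'a set \<Rightarrow> bool" where
  "subspace_over E V \<longleftrightarrow> 0 \<in> V \<and> (\<forall>x\<in>V. \<forall>y\<in>V. x + y \<in> V) \<and> (\<forall>c\<in>E. \<forall>x\<in>V. c * x \<in> V)"

definition span_over :: "'a::field set \<Rightarrow> nat \<Rightarrow> (nat \<Rightarrow> 'a) \<Rightarrow> 'a set" where
  "span_over E n v = {\<Sum>i=1..n. c i * v i | c. \<forall>i\<in>{1..n}. c i \<in> E}"

definition lin_indep_over :: "'a::field set \<Rightarrow> nat \<Rightarrow> (nat \<Rightarrow> 'a) \<Rightarrow> bool" where
  "lin_indep_over E n v \<longleftrightarrow>
     (\<forall>c. (\<forall>i\<in>{1..n}. c i \<in> E) \<longrightarrow> (\<Sum>i=1..n. c i * v i) = 0 \<longrightarrow> (\<forall>i\<in>{1..n}. c i = 0))"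

definition basis_over :: "'a::field set \<Rightarrow> 'a set \<Rightarrow> nat \<Rightarrow> (nat \<Rightarrow> 'a) \<Rightarrow> bool" where
  "basis_over E V n v \<longleftrightarrow> lin_indep_over E n v \<and> span_over E n v = V"

definition subspace_of_dim :: "'a::field set \<Rightarrow> 'a set \<Rightarrow> nat \<Rightarrow> bool" where
  "subspace_of_dim E V n \<longleftrightarrow> subspace_over E V \<and> (\<exists>v. basis_over E V n v)"

(* Tr from F_(2^l) to F_2 as the sum of the Frobenius conjugates; its values 0, 1 are kept in F. *)
definition trace2 :: "nat \<Rightarrow> 'a::field \<Rightarrow> 'a" where
  "trace2 l x = (\<Sum>i<l. x ^ (2 ^ i))"

(* The set b^(-1) K with K the kernel of the trace. *)
definition scaled_trace_ker :: "nat \<Rightarrow> 'a::field \<Rightarrow> 'a set" where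
  "scaled_trace_ker l b = (\<lambda>x. inverse b * x) ` {x. trace2 l x = 0}"

(* Nodes of RS(A,k) are identified with their evaluation points, so n = card A and the failed
   node is a point a of A. The code enters only through the evaluation set A and k. *)
definition linear_repair_scheme ::
    "nat \<Rightarrow> 'a::field set \<Rightarrow> nat \<Rightarrow> 'a \<Rightarrow> (nat \<Rightarrow> 'a poly) \<Rightarrow> bool" where
  "linear_repair_scheme l A k a g \<longleftrightarrow>
     finite A \<and> 1 \<le> k \<and> k < card A \<and> a \<in> A \<and>
     (\<forall>j\<in>{1..l}. degree (g j) < card A - k) \<and>
     lin_indep_over prime_field2 l (\<lambda>j. poly (g j) a)"

definition repair_matrix ::
    "nat \<Rightarrow> (nat \<Rightarrow> 'a::field poly) \<Rightarrow> (nat \<Rightarrow> 'a) \<Rightarrow> 'a \<Rightarrow> nat \<Rightarrow> nat \<Rightarrow> 'a" where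
  "repair_matrix l g \<beta> x j \<nu> = trace2 l (poly (g j) x * \<beta> \<nu>)"

definition nz :: "nat \<Rightarrow> (nat \<Rightarrow> nat \<Rightarrow> 'a::zero) \<Rightarrow> nat" where
  "nz l W = card {\<nu>\<in>{1..l}. \<exists>j\<in>{1..l}. W j \<nu> \<noteq> 0}"

definition io_cost ::
    "nat \<Rightarrow> 'a::field set \<Rightarrow> 'a \<Rightarrow> (nat \<Rightarrow> 'a poly) \<Rightarrow> (nat \<Rightarrow> 'a) \<Rightarrow> nat" where
  "io_cost l A a g \<beta> = (\<Sum>x\<in>A - {a}. nz l (repair_matrix l g \<beta> x))"

definition constr_L :: "'a::field \<Rightarrow> 'a \<Rightarrow> 'a poly" where
  "constr_L \<theta>0 \<theta>1 = [:0, \<theta>0, \<theta>1:]"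

definition constr_W :: "nat \<Rightarrow> nat \<Rightarrow> (nat \<Rightarrow> 'a::field) \<Rightarrow> 'a set" where
  "constr_W l d \<beta> = (\<Inter>i\<in>{2..l - d + 2}. scaled_trace_ker l (\<beta> i))"

definition constr_A :: "nat \<Rightarrow> nat \<Rightarrow> (nat \<Rightarrow> 'a::field) \<Rightarrow> 'a \<Rightarrow> 'a \<Rightarrow> 'a set" where
  "constr_A l d \<beta> \<theta>0 \<theta>1 = {x. poly (constr_L \<theta>0 \<theta>1) x \<in> constr_W l d \<beta>}"

definition constr_g ::
    "nat \<Rightarrow> nat \<Rightarrow> (nat \<Rightarrow> 'a::field) \<Rightarrow> 'a \<Rightarrow> 'a \<Rightarrow> nat \<Rightarrow> 'a poly" where
  "constr_g l d \<gamma> \<theta>0 \<theta>1 j =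
     (if j \<le> l - d + 2 then smult (\<gamma> j) (constr_L \<theta>0 \<theta>1) + [:\<gamma> j:] else [:\<gamma> j:])"

(* Admissible choices in the construction: E is the subfield F_(2^m) with m = l - d + 2,
   \<lambda> is called lam, and \<beta> is the trace-dual basis of \<gamma>. *)
definition construction_data ::
    "nat \<Rightarrow> nat \<Rightarrow> 'a::field set \<Rightarrow> (nat \<Rightarrow> 'a) \<Rightarrow> (nat \<Rightarrow> 'a) \<Rightarrow> (nat \<Rightarrow> 'a) \<Rightarrow> 'a \<Rightarrow> 'a \<Rightarrow> bool" where
  "construction_data l d E \<gamma> lam \<beta> \<theta>0 \<theta>1 \<longleftrightarrow>
     (let m = l - d + 2 in
      is_subfield E \<and> card E = 2 ^ m \<and>
      basis_over prime_field2 E m \<gamma> \<and> \<gamma> 1 = 1 \<and>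
      basis_over E UNIV (l div m) lam \<and> lam 1 = 1 \<and>
      (\<forall>i\<in>{1..l div m}. \<forall>j\<in>{1..m}. \<gamma> ((i - 1) * m + j) = lam i * \<gamma> j) \<and>
      (\<forall>i\<in>{1..l}. \<forall>j\<in>{1..l}. trace2 l (\<beta> i * \<gamma> j) = (if i = j then 1 else 0)) \<and>
      \<theta>1 \<noteq> 0 \<and> range (poly (constr_L \<theta>0 \<theta>1)) = scaled_trace_ker l (\<beta> 2))"

end

theory Submission
  imports Defs "HOL-Library.FuncSet"
begin

text \<open>
  Columns that vanish are free, so minimizing the I/O cost means maximizing the number of pairs
  of a helper node and a vanishing column.

  In the construction, write a node value \<open>L(x) \<in> W\<close> as \<open>c + \<Sum>\<^sub>i\<^sub>\<ge>\<^sub>2 \<lambda>\<^sub>i e\<^sub>i\<close> with \<open>e\<^sub>i\<close> in the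
  subfield. The first \<open>m\<close> dual basis elements do not see the second summand, even after
  multiplication by an element of the subfield, so the upper left \<open>m \<times> m\<close> block of the matrix is
  \<open>c + 1\<close> times the identity. It vanishes at half of the points of \<open>A\<close>, and all other
  columns are nonzero.

  For optimality, take an arbitrary scheme of quadratic polynomials, translate the failed node to
  \<open>0\<close> and parametrize the scheme by its value: \<open>h\<^sub>c(x) = c + P(c) x + Q(c) x\<^sup>2\<close> with
  \<open>P\<close>, \<open>Q\<close> additive. If column \<open>\<nu>\<close> vanishes anywhere, it vanishes on a coset of codimension
  \<open>r\<^sub>\<nu>\<close> in \<open>A\<close>, and the space \<open>V\<^sub>\<nu>\<close> of those \<open>c\<close> for which \<open>Tr(h\<^sub>c \<beta>\<^sub>\<nu>)\<close> is constant on
  \<open>A\<close> has the same codimension \<open>r\<^sub>\<nu>\<close> in the field; moreover \<open>Tr(c \<beta>\<^sub>\<nu>) = 0\<close> on \<open>V\<^sub>\<nu>\<close>, so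
  \<open>r\<^sub>\<nu> \<ge> 1\<close>. A nonconstant \<open>h\<^sub>c\<close> has at most two zeros of its linear part, so \<open>c\<close> lies in at most
  \<open>m - 1\<close> of the \<open>V\<^sub>\<nu>\<close>. Hence any \<open>m\<close> of the \<open>V\<^sub>\<nu>\<close> meet only in elements annihilated by all
  \<open>t\<close> relevant \<open>\<beta>\<^sub>\<nu>\<close>, which makes the sum of any \<open>m\<close> of the \<open>r\<^sub>\<nu>\<close> at least \<open>t\<close>. This
  forces \<open>\<Sum> 2\<^sup>1\<^sup>-\<^sup>r \<le> m\<close>.
\<close>

section \<open>Linear algebra over a finite subfield\<close>

lemma span_over_cong:
  assumes "\<And>i. i \<in> {1..n} \<Longrightarrow> v i = w i"
  shows "span_over E n v = span_over E n w"
proof -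
  have "(\<Sum>i=1..n. c i * v i) = (\<Sum>i=1..n. c i * w i)" for c
    using assms by (intro sum.cong) auto
  then show ?thesis by (simp add: span_over_def)
qed

lemma lin_indep_over_cong:
  assumes "\<And>i. i \<in> {1..n} \<Longrightarrow> v i = w i"
  shows "lin_indep_over E n v \<longleftrightarrow> lin_indep_over E n w"
proof -
  have "(\<Sum>i=1..n. c i * v i) = (\<Sum>i=1..n. c i * w i)" for c
    using assms by (intro sum.cong) auto
  then show ?thesis by (simp add: lin_indep_over_def)
qed

lemma basis_over_cong:
  assumes "\<And>i. i \<in> {1..n} \<Longrightarrow> v i = w i"
  shows "basis_over E V n v \<longleftrightarrow> basis_over E V n w"
  unfolding basis_over_def
  using span_over_cong[OF assms] lin_indep_over_cong[OF assms] by simp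

lemma basis_over_mem:
  assumes "is_subfield E" "basis_over E V n v" "j \<in> {1..n}"
  shows "v j \<in> V"
proof -
  have "v j = (\<Sum>i=1..n. (if i = j then 1 else 0) * v i)"
    using assms(3) by (simp add: if_distrib[of "\<lambda>x. x * _"] cong: if_cong)
  then have "v j \<in> span_over E n v" unfolding span_over_def
    using assms(1)
    by (intro CollectI exI[of _ "\<lambda>i. if i = j then 1 else 0"]) (auto simp: is_subfield_def)
  then show ?thesis using assms(2) by (simp add: basis_over_def)
qed

lemma is_subfield_minus:
  assumes "is_subfield E" "x \<in> E" "y \<in> E"
  shows "x - y \<in> E"
proof -
  have "x + (- y) \<in> E" using assms unfolding is_subfield_def by blast
  then show ?thesis by simp
qed

text \<open>Dimensions are compared through cardinalities below. Extensional coefficient vectors map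
  bijectively onto the span, injectivity being independence applied to a difference.\<close>

lemma card_span_over:
  assumes E: "is_subfield E" and ind: "lin_indep_over E n v"
  shows "card (span_over E n v) = card E ^ n"
proof -
  let ?f = "\<lambda>c. \<Sum>i=1..n. c i * v i"
  have "span_over E n v = ?f ` (\<Pi>\<^sub>E i\<in>{1..n}. E)"
  proof (intro equalityI subsetI)
    fix x assume "x \<in> span_over E n v"
    then obtain c where c: "\<forall>i\<in>{1..n}. c i \<in> E" "x = ?f c"
      unfolding span_over_def by blast
    have "x = ?f (restrict c {1..n})" unfolding c(2) by (intro sum.cong) auto
    moreover have "restrict c {1..n} \<in> (\<Pi>\<^sub>E i\<in>{1..n}. E)" using c(1) by auto
    ultimately show "x \<in> ?f ` (\<Pi>\<^sub>E i\<in>{1..n}. E)" by blast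
  next
    fix x assume "x \<in> ?f ` (\<Pi>\<^sub>E i\<in>{1..n}. E)"
    then show "x \<in> span_over E n v" unfolding span_over_def by (auto simp: PiE_iff)
  qed
  moreover have "inj_on ?f (\<Pi>\<^sub>E i\<in>{1..n}. E)"
  proof (rule inj_onI)
    fix c c' assume c: "c \<in> (\<Pi>\<^sub>E i\<in>{1..n}. E)" "c' \<in> (\<Pi>\<^sub>E i\<in>{1..n}. E)" and eq: "?f c = ?f c'"
    have "(\<Sum>i=1..n. (c i - c' i) * v i) = 0"
      using eq by (simp add: left_diff_distrib sum_subtractf)
    moreover have "\<forall>i\<in>{1..n}. c i - c' i \<in> E"
      using c is_subfield_minus[OF E] by (auto simp: PiE_iff)
    ultimately have "\<forall>i\<in>{1..n}. c i - c' i = 0"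
      using ind unfolding lin_indep_over_def by (elim allE[of _ "\<lambda>i. c i - c' i"]) blast
    then show "c = c'" using c by (intro PiE_ext[OF c]) auto
  qed
  ultimately have "card (span_over E n v) = card (\<Pi>\<^sub>E i\<in>{1..n}. E)"
    by (simp add: card_image)
  then show ?thesis by (simp add: card_PiE)
qed

lemma subspace_over_sum:
  assumes "subspace_over E V" "finite I" "\<forall>i\<in>I. c i \<in> E" "\<forall>i\<in>I. v i \<in> V"
  shows "(\<Sum>i\<in>I. c i * v i) \<in> V"
  using assms(2-4)
proof (induction I rule: finite_induct)
  case empty
  then show ?case using assms(1) by (simp add: subspace_over_def)
next
  case (insert i I)
  then show ?case using assms(1) by (simp add: subspace_over_def)
qed

lemma lin_indep_over_extend:
  assumes E: "is_subfield E" and ind: "lin_indep_over E n v" and x: "x \<notin> span_over E n v"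
  shows "lin_indep_over E (Suc n) (v(Suc n := x))"
  unfolding lin_indep_over_def
proof (intro allI impI)
  fix c assume c: "\<forall>i\<in>{1..Suc n}. c i \<in> E"
    and sum0: "(\<Sum>i=1..Suc n. c i * (v(Suc n := x)) i) = 0"
  have "(\<Sum>i=1..n. c i * (v(Suc n := x)) i) = (\<Sum>i=1..n. c i * v i)"
    by (intro sum.cong) auto
  then have eq: "(\<Sum>i=1..n. c i * v i) + c (Suc n) * x = 0"
    using sum0 by simp
  have cn: "c (Suc n) = 0"
  proof (rule ccontr)
    assume nz: "c (Suc n) \<noteq> 0"
    have "x = inverse (c (Suc n)) * (c (Suc n) * x)" using nz by simp
    also have "c (Suc n) * x = - (\<Sum>i=1..n. c i * v i)"
      using eq by (metis add.inverse_unique add.commute)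
    finally have "x = (\<Sum>i=1..n. (inverse (c (Suc n)) * - c i) * v i)"
      by (simp add: sum_distrib_left sum_negf mult.assoc)
    moreover have "\<forall>i\<in>{1..n}. inverse (c (Suc n)) * - c i \<in> E"
      using c E unfolding is_subfield_def by auto
    ultimately have "x \<in> span_over E n v" unfolding span_over_def
      by (intro CollectI exI[of _ "\<lambda>i. inverse (c (Suc n)) * - c i"]) simp
    with x show False by blast
  qed
  with eq have "(\<Sum>i=1..n. c i * v i) = 0" by simp
  then have "\<forall>i\<in>{1..n}. c i = 0"
    using ind c unfolding lin_indep_over_def by auto
  then show "\<forall>i\<in>{1..Suc n}. c i = 0" using cn by (auto simp: le_Suc_eq)
qed

text \<open>The first vector is prescribed because the construction asks for
  \<open>\<gamma> 1 = 1\<close> and \<open>lam 1 = 1\<close>. A maximal independent family starting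
  with \<open>u\<close> must span; lengths are bounded since n < 2^n and the span stays inside
  \<open>V\<close>.\<close>

lemma basis_over_exists:
  fixes E V :: "'a::field set"
  assumes E: "is_subfield E" "finite E" and V: "subspace_over E V" "finite V"
    and u: "u \<in> V" "u \<noteq> 0"
  obtains n v where "n \<ge> 1" "v 1 = u" "basis_over E V n v"
proof -
  define P where "P n \<longleftrightarrow> (\<exists>v. n \<ge> 1 \<and> v 1 = u \<and> lin_indep_over E n v \<and> (\<forall>i\<in>{1..n}. v i \<in> V))"
    for n
  have sub: "span_over E n v \<subseteq> V" if "\<forall>i\<in>{1..n}. v i \<in> V" for n v
    unfolding span_over_def using subspace_over_sum[OF V(1)] that by auto
  have "{0, 1} \<subseteq> E" using E(1) by (auto simp: is_subfield_def)
  then have "card {0, 1::'a} \<le> card E" by (intro card_mono E)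
  then have cE: "card E \<ge> 2" by simp
  have bound: "n \<le> card V" if Pn: "P n" for n
  proof -
    obtain v where v: "lin_indep_over E n v" "\<forall>i\<in>{1..n}. v i \<in> V"
      using Pn unfolding P_def by blast
    have "n < 2 ^ n" by (rule less_exp)
    also have "2 ^ n \<le> card E ^ n" using cE by (intro power_mono) auto
    also have "\<dots> = card (span_over E n v)" using card_span_over[OF E(1) v(1)] by simp
    also have "\<dots> \<le> card V" by (intro card_mono V sub v)
    finally show ?thesis by simp
  qed
  have "P 1" unfolding P_def lin_indep_over_def
    using u by (intro exI[of _ "\<lambda>_. u"]) auto
  then obtain n where n: "P n" "\<forall>n'. P n' \<longrightarrow> n' \<le> n"
    using GreatestI_nat[of P 1 "card V"] Greatest_le_nat[of P _ "card V"] bound by blast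
  then obtain v where v: "n \<ge> 1" "v 1 = u" "lin_indep_over E n v" "\<forall>i\<in>{1..n}. v i \<in> V"
    unfolding P_def by blast
  have "span_over E n v = V"
  proof (rule ccontr)
    assume "span_over E n v \<noteq> V"
    then obtain x where x: "x \<in> V" "x \<notin> span_over E n v" using sub v(4) by blast
    have "P (Suc n)" unfolding P_def
      using lin_indep_over_extend[OF E(1) v(3) x(2)] v x
      by (intro exI[of _ "v(Suc n := x)"]) (auto simp: le_Suc_eq)
    then show False using n(2) by fastforce
  qed
  then show ?thesis using that v unfolding basis_over_def by blast
qed

section \<open>A combinatorial inequality for sums of powers of two\<close>

lemma subset_with_least_values:
  fixes f :: "'b \<Rightarrow> nat"
  assumes "finite T" "m \<le> card T"
  obtains S where "S \<subseteq> T" "card S = m" "\<forall>x\<in>S. \<forall>y\<in>T - S. f x \<le> f y"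
proof -
  have "\<exists>S\<subseteq>T. card S = m \<and> (\<forall>x\<in>S. \<forall>y\<in>T - S. f x \<le> f y)"
    using assms(2)
  proof (induction m)
    case 0
    then show ?case by (intro exI[of _ "{}"]) auto
  next
    case (Suc m)
    then obtain S where S: "S \<subseteq> T" "card S = m" "\<forall>x\<in>S. \<forall>y\<in>T - S. f x \<le> f y" by auto
    then have "T - S \<noteq> {}" using Suc.prems by auto
    then obtain z where z: "z \<in> T - S" "\<forall>y\<in>T - S. f z \<le> f y"
      using ex_min_if_finite[of "f ` (T - S)"] assms(1)
      by (metis arg_min_if_finite(1) arg_min_least finite_Diff)
    show ?case
      using S z finite_subset[OF S(1) assms(1)] by (intro exI[of _ "insert z S"]) auto
  qed
  then show ?thesis using that by blast
qed

text \<open>The bound is attained when all \<^term>\<open>r \<nu>\<close> equal 1 or all equal 2: a term outside the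
  \<open>m\<close> least values is charged to one of the units by which these exceed 1, which costs
  \<open>r / 2\<^sup>r\<^sup>-\<^sup>1 \<le> 1\<close> for each of the \<open>m\<close> values.\<close>

lemma sum_halving_powers_le:
  fixes r :: "'b \<Rightarrow> nat" and d m :: nat
  assumes T: "finite T" and r: "\<And>\<nu>. \<nu> \<in> T \<Longrightarrow> 1 \<le> r \<nu> \<and> r \<nu> \<le> d"
    and S: "\<And>S. S \<subseteq> T \<Longrightarrow> card S = m \<Longrightarrow> card T \<le> (\<Sum>\<nu>\<in>S. r \<nu>)"
  shows "(\<Sum>\<nu>\<in>T. 2 ^ (d - r \<nu>)) \<le> m * (2::nat) ^ (d - 1)"
proof (cases "card T \<le> m")
  case True
  have "(\<Sum>\<nu>\<in>T. 2 ^ (d - r \<nu>)) \<le> (\<Sum>\<nu>\<in>T. (2::nat) ^ (d - 1))"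
    using r by (intro sum_mono power_increasing diff_le_mono2) auto
  also have "\<dots> \<le> m * 2 ^ (d - 1)" using True by simp
  finally show ?thesis .
next
  case False
  obtain S where S': "S \<subseteq> T" "card S = m" "\<forall>x\<in>S. \<forall>y\<in>T - S. r x \<le> r y"
    using subset_with_least_values[OF T, of m] False by auto
  have finS: "finite S" using S'(1) T finite_subset by blast
  show ?thesis
  proof (cases "S = {}")
    case True
    \<comment> \<open>Here m = 0, and the hypothesis at the empty subset would force
      \<open>T\<close> to be empty.\<close>
    then show ?thesis using S'(2) S[of "{}"] False by simp
  next
    case Sne: False
    \<comment> \<open>\<open>\<rho>\<close> separates the values: inside \<open>S\<close> they are
      at most \<open>\<rho>\<close>, outside at least \<open>\<rho>\<close>. So a term outside costs
      at most 2^(d - \<rho>), which is at most any term inside.\<close>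
    define \<rho> where "\<rho> = Max (r ` S)"
    have \<rho>: "r x \<le> \<rho>" if "x \<in> S" for x unfolding \<rho>_def using that finS by simp
    have "\<rho> \<in> r ` S" unfolding \<rho>_def using finS Sne by (intro Max_in) auto
    then have \<rho>': "\<rho> \<le> r y" if "y \<in> T - S" for y using S'(3) that by auto
    have "card (T - S) + card S = card T"
      using S'(1) T by (metis add.commute card_Diff_subset card_mono finS le_add_diff_inverse)
    moreover have "(\<Sum>\<nu>\<in>S. r \<nu>) = (\<Sum>\<nu>\<in>S. r \<nu> - 1) + card S"
    proof -
      have "(\<Sum>\<nu>\<in>S. r \<nu>) = (\<Sum>\<nu>\<in>S. (r \<nu> - 1) + 1)"
        using r S'(1) by (intro sum.cong) force+
      then show ?thesis by (simp only: sum.distrib) simp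
    qed
    \<comment> \<open>Subtracting the m units common to both sides leaves at least one unit of
      excess inside \<open>S\<close> for every element outside.\<close>
    ultimately have cd: "card (T - S) \<le> (\<Sum>\<nu>\<in>S. r \<nu> - 1)" using S[OF S'(1,2)] by linarith
    have "(\<Sum>\<nu>\<in>T. 2 ^ (d - r \<nu>)) = (\<Sum>\<nu>\<in>S. 2 ^ (d - r \<nu>)) + (\<Sum>\<nu>\<in>T - S. (2::nat) ^ (d - r \<nu>))"
      using S'(1) T by (metis add.commute sum.subset_diff)
    also have "(\<Sum>\<nu>\<in>T - S. (2::nat) ^ (d - r \<nu>)) \<le> (\<Sum>\<nu>\<in>T - S. 2 ^ (d - \<rho>))"
      using \<rho>' by (intro sum_mono power_increasing diff_le_mono2) auto
    also have "\<dots> = card (T - S) * 2 ^ (d - \<rho>)" by simp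
    also have "\<dots> \<le> (\<Sum>\<nu>\<in>S. r \<nu> - 1) * 2 ^ (d - \<rho>)" using cd by simp
    also have "\<dots> = (\<Sum>\<nu>\<in>S. (r \<nu> - 1) * 2 ^ (d - \<rho>))" by (simp add: sum_distrib_right)
    also have "\<dots> \<le> (\<Sum>\<nu>\<in>S. (r \<nu> - 1) * 2 ^ (d - r \<nu>))"
      using \<rho> by (intro sum_mono mult_left_mono power_increasing diff_le_mono2) auto
    also have "(\<Sum>\<nu>\<in>S. 2 ^ (d - r \<nu>)) + \<dots> = (\<Sum>\<nu>\<in>S. r \<nu> * 2 ^ (d - r \<nu>))"
      unfolding sum.distrib[symmetric]
    proof (intro sum.cong refl)
      fix \<nu> assume "\<nu> \<in> S"
      then have "r \<nu> = Suc (r \<nu> - 1)" using r S'(1) by force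
      then show "2 ^ (d - r \<nu>) + (r \<nu> - 1) * 2 ^ (d - r \<nu>) = r \<nu> * 2 ^ (d - r \<nu>)"
        by (metis mult_Suc)
    qed
    also have "\<dots> \<le> (\<Sum>\<nu>\<in>S. 2 ^ (d - 1))"
    proof (intro sum_mono)
      fix \<nu> assume "\<nu> \<in> S"
      then have r1: "1 \<le> r \<nu>" "r \<nu> \<le> d" using r S'(1) by auto
      have "r \<nu> \<le> 2 ^ (r \<nu> - 1)" using less_exp[of "r \<nu> - 1"] r1 by linarith
      then have "r \<nu> * 2 ^ (d - r \<nu>) \<le> 2 ^ (r \<nu> - 1) * 2 ^ (d - r \<nu>)" by simp
      also have "\<dots> = 2 ^ (d - 1)" using r1 by (simp flip: power_add)
      finally show "r \<nu> * 2 ^ (d - r \<nu>) \<le> 2 ^ (d - 1)" .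
    qed
    also have "\<dots> = m * 2 ^ (d - 1)" using S'(2) by simp
    finally show ?thesis by simp
  qed
qed

section \<open>Trace duality in characteristic two\<close>

locale binary_field =
  fixes F :: "'a::{field,finite} itself" and l :: nat
  assumes card_UNIV: "card (UNIV :: 'a set) = 2 ^ l" and l_pos: "l \<ge> 1"
begin

text \<open>Translation by 1 permutes the field, so the sum of all elements does not change and 2^l
  = 0 in the field, whence 2 = 0.\<close>

lemma add_self [simp]: "x + x = (0::'a)"
proof -
  have "(\<Sum>x\<in>UNIV. x + 1) = (\<Sum>x\<in>UNIV. x::'a)"
    by (rule sum.reindex_bij_witness[of _ "\<lambda>x. x - 1" "\<lambda>x. x + 1"]) auto
  then have "of_nat (card (UNIV :: 'a set)) = (0::'a)" by (simp add: sum.distrib)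
  then have "(2::'a) = 0" by (simp add: card_UNIV)
  then have "2 * x = 0" by simp
  then show ?thesis by (simp only: mult_2)
qed

lemma minus_eq [simp]: "- x = (x::'a)"
  by (rule minus_unique) simp

lemma add_self_left [simp]: "x + (x + y) = (y::'a)"
  by (simp flip: add.assoc)

lemma add_eq_0_iff_eq: "x + y = 0 \<longleftrightarrow> x = (y::'a)"
  by (metis add_self_left add.right_neutral)

lemma is_subfield_prime_field2: "is_subfield (prime_field2 :: 'a set)"
  unfolding is_subfield_def prime_field2_def by auto

lemma card_prime_field2: "card (prime_field2 :: 'a set) = 2"
  by (simp add: prime_field2_def)

lemma subspace2_iff:
  "subspace_over (prime_field2 :: 'a set) V \<longleftrightarrow> 0 \<in> V \<and> (\<forall>x\<in>V. \<forall>y\<in>V. x + y \<in> V)"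
  unfolding subspace_over_def prime_field2_def by auto

lemma square_add: "(x + y)\<^sup>2 = x\<^sup>2 + (y::'a)\<^sup>2"
  by (simp add: power2_eq_square algebra_simps)

lemma frob_add: "(x + y) ^ (2 ^ i) = x ^ (2 ^ i) + (y::'a) ^ (2 ^ i)"
proof (induction i)
  case (Suc i)
  have "z ^ (2 ^ Suc i) = (z ^ (2 ^ i))\<^sup>2" for z :: 'a by (simp add: mult.commute flip: power_mult)
  then show ?case using Suc by (simp add: square_add)
qed simp

text \<open>Multiplication by a nonzero x permutes the nonzero elements; comparing their products
  gives x^(2^l - 1) = 1.\<close>

lemma power_card: "x ^ (2 ^ l) = (x::'a)"
proof (cases "x = 0")
  case False
  have "(\<Prod>y\<in>UNIV-{0}. x * y) = x ^ (card (UNIV :: 'a set) - 1) * \<Prod>(UNIV-{0})"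
    by (simp add: prod.distrib)
  also have "(\<Prod>y\<in>UNIV-{0}. x * y) = (\<Prod>y\<in>UNIV-{0}. y)"
    by (rule prod.reindex_bij_witness[of _ "\<lambda>y. y / x" "\<lambda>y. x * y"]) (use False in auto)
  finally have "x ^ (card (UNIV :: 'a set) - 1) = 1" by simp
  then have "x * x ^ (2 ^ l - 1) = x" by (simp add: card_UNIV)
  moreover have "Suc (2 ^ l - 1) = 2 ^ l" by simp
  ultimately show ?thesis by (metis power_Suc)
qed simp

text \<open>Rank-nullity in multiplicative form: each nonempty fibre is a translate of the
  kernel.\<close>

lemma card_subspace_image_kernel:
  fixes f :: "'a \<Rightarrow> 'a"
  assumes V: "subspace_over prime_field2 V" and f: "\<And>x y. f (x + y) = f x + f y"
  shows "card V = card (f ` V) * card {x\<in>V. f x = 0}"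
proof -
  have fib: "card {x\<in>V. f x = y} = card {x\<in>V. f x = 0}" if y: "y \<in> f ` V" for y
  proof -
    obtain x0 where x0: "x0 \<in> V" "y = f x0" using y by blast
    have "bij_betw (\<lambda>x. x + x0) {x\<in>V. f x = y} {x\<in>V. f x = 0}"
      by (rule bij_betw_byWitness[of _ "\<lambda>x. x + x0"])
        (use V x0 in \<open>auto simp: subspace2_iff f add.assoc\<close>)
    then show ?thesis by (rule bij_betw_same_card)
  qed
  have "card V = (\<Sum>y\<in>f ` V. card {x\<in>V. f x = y})"
    using sum.image_gen[of V "\<lambda>_. 1::nat" f] by simp
  also have "\<dots> = (\<Sum>y\<in>f ` V. card {x\<in>V. f x = 0})" using fib by (intro sum.cong) auto
  finally show ?thesis by simp
qed

lemma card_subspace_power: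
  assumes "subspace_over (prime_field2 :: 'a set) V"
  obtains r where "card V = 2 ^ r"
proof (cases "V = {0}")
  case True
  then show ?thesis using that[of 0] by simp
next
  case False
  then obtain u where "u \<in> V" "u \<noteq> 0" using assms by (auto simp: subspace_over_def)
  from basis_over_exists[OF is_subfield_prime_field2 _ assms _ this]
  obtain n v where "basis_over prime_field2 V n v" using finite by metis
  then have "card V = 2 ^ n"
    using card_span_over[OF is_subfield_prime_field2, of n v] card_prime_field2
    by (simp add: basis_over_def)
  then show ?thesis by (rule that)
qed

lemma subspace_of_dimI:
  assumes V: "subspace_over (prime_field2 :: 'a set) V" and card: "card V = 2 ^ n" and "n \<ge> 1"
  shows "subspace_of_dim prime_field2 V n"
proof -
  have "V \<noteq> {0}"
  proof
    assume "V = {0}"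
    with card have "(2::nat) ^ n = 1" by simp
    then show False using \<open>n \<ge> 1\<close> by simp
  qed
  then obtain u where "u \<in> V" "u \<noteq> 0" using V by (auto simp: subspace_over_def)
  from basis_over_exists[OF is_subfield_prime_field2 _ V _ this]
  obtain n' v where v: "basis_over prime_field2 V n' v" using finite by metis
  then have "card V = 2 ^ n'"
    using card_span_over[OF is_subfield_prime_field2, of n' v] card_prime_field2
    by (simp add: basis_over_def)
  with card have "n' = n" by simp
  then show ?thesis using V v by (auto simp: subspace_of_dim_def)
qed

lemma basis2I:
  fixes v :: "nat \<Rightarrow> 'a"
  assumes "lin_indep_over prime_field2 l v"
  shows "basis_over prime_field2 UNIV l v"
proof -
  have "card (span_over prime_field2 l v) = card (UNIV :: 'a set)"
    using card_span_over[OF is_subfield_prime_field2 assms] card_UNIV by (simp add: card_prime_field2)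
  then have "span_over prime_field2 l v = UNIV" by (simp add: card_subset_eq)
  then show ?thesis using assms by (simp add: basis_over_def)
qed

abbreviation tr :: "'a \<Rightarrow> 'a" where "tr \<equiv> trace2 l"

lemma tr_add: "tr (x + y) = tr x + tr y"
  by (simp add: trace2_def frob_add sum.distrib)

lemma tr_0 [simp]: "tr 0 = 0"
  by (simp add: trace2_def power_0_left)

lemma tr_sum: "tr (\<Sum>i\<in>I. f i) = (\<Sum>i\<in>I. tr (f i))"
  by (induction I rule: infinite_finite_induct) (simp_all add: tr_add)

lemma square_sum: "(\<Sum>i\<in>I. f i)\<^sup>2 = (\<Sum>i\<in>I. (f i :: 'a)\<^sup>2)"
  by (induction I rule: infinite_finite_induct) (simp_all add: square_add)

lemma tr_square: "tr (x\<^sup>2) = tr x"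
proof -
  have "tr (x\<^sup>2) = (\<Sum>i<l. x ^ (2 ^ Suc i))"
    by (simp add: trace2_def flip: power_mult)
  \<comment> \<open>Squaring shifts the conjugates by one. The missing first term x is the same as
    the surplus last term x^(2^l).\<close>
  also have "\<dots> + x ^ (2 ^ 0) = (\<Sum>i<Suc l. x ^ (2 ^ i))"
    by (simp only: sum.lessThan_Suc_shift[of _ l] add.commute)
  also have "\<dots> = tr x + x ^ (2 ^ l)" by (simp add: trace2_def)
  finally have "tr (x\<^sup>2) + x = tr x + x" by (simp add: power_card)
  then show ?thesis by simp
qed

text \<open>The trace is its own square, because squaring only permutes the conjugates; the
  solutions of t^2 = t are 0 and 1.\<close>

lemma tr_in: "tr x \<in> prime_field2"
proof -
  have "(tr x)\<^sup>2 = tr (x\<^sup>2)"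
    by (simp add: trace2_def square_sum mult.commute flip: power_mult)
  then have "tr x * tr x = tr x" unfolding tr_square unfolding power2_eq_square .
  then show ?thesis by (simp add: prime_field2_def)
qed

lemma tr_cases: "tr x = 0 \<or> tr x = 1"
  using tr_in[of x] by (simp add: prime_field2_def)

lemma tr_scale: "c \<in> prime_field2 \<Longrightarrow> tr (c * x) = c * tr x"
  by (auto simp: prime_field2_def)

text \<open>As a polynomial the trace has linear coefficient 1 and degree at most 2^(l-1), so it has
  too few roots to vanish on the whole field.\<close>

lemma tr_nonzero: obtains x where "tr x = 1"
proof -
  define p :: "'a poly" where "p = (\<Sum>i<l. monom 1 (2 ^ i))"
  have poly: "poly p x = tr x" for x by (simp add: p_def trace2_def poly_sum poly_monom)
  have "degree p \<le> 2 ^ (l - 1)" unfolding p_def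
    by (intro degree_sum_le order.trans[OF degree_monom_le] power_increasing) auto
  moreover have "(2::nat) ^ (l - 1) < 2 ^ l" using l_pos by simp
  moreover have "coeff p 1 = 1"
  proof -
    have "coeff p 1 = (\<Sum>i<l. if i = 0 then 1 else 0)"
      unfolding p_def coeff_sum by (intro sum.cong) auto
    then show ?thesis using l_pos by simp
  qed
  then have "p \<noteq> 0" by auto
  ultimately have "card {x. poly p x = 0} < card (UNIV :: 'a set)"
    using card_poly_roots_bound[of p] card_UNIV by linarith
  then have "{x. poly p x = 0} \<noteq> UNIV" by auto
  then show ?thesis using that tr_cases poly by auto
qed

lemma tr_nondegenerate:
  assumes "\<And>y. tr (x * y) = 0"
  shows "x = 0"
proof (rule ccontr)
  assume x: "x \<noteq> 0"
  obtain z where "tr z = 1" by (rule tr_nonzero)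
  then show False using assms[of "inverse x * z"] x by (simp flip: mult.assoc)
qed

text \<open>The image is {0} or {0, 1}, so the kernel is everything or exactly half. The doubled
  form treats both cases without division.\<close>

lemma card_kernel_half:
  fixes f :: "'a \<Rightarrow> 'a"
  assumes V: "subspace_over prime_field2 V" and f: "\<And>x y. f (x + y) = f x + f y"
    and im: "\<And>x. f x \<in> (prime_field2 :: 'a set)"
  shows "2 * card {x\<in>V. f x = 0} = (if \<forall>x\<in>V. f x = 0 then 2 else 1) * card V"
proof (cases "\<forall>x\<in>V. f x = 0")
  case True
  then have "{x\<in>V. f x = 0} = V" by auto
  then show ?thesis using True by simp
next
  case False
  have "f 0 = 0" using f[of 0 0] by simp
  then have "0 \<in> f ` V" using V by (metis imageI subspace_over_def)
  moreover have "1 \<in> f ` V" using False im by (force simp: prime_field2_def)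
  ultimately have "f ` V = {0, 1}" using im by (auto simp: prime_field2_def)
  then have "card (f ` V) = 2" by simp
  then show ?thesis
    using card_subspace_image_kernel[OF V, of f] f unfolding if_not_P[OF False] by simp
qed

text \<open>Both sides come from counting the zeros \<^term>\<open>(x, c)\<close> of the form in two ways.\<close>

lemma card_annihilators:
  fixes b :: "'a \<Rightarrow> 'a \<Rightarrow> 'a"
  assumes A: "subspace_over prime_field2 A" and C: "subspace_over prime_field2 C"
    and b1: "\<And>x x' c. b (x + x') c = b x c + b x' c"
    and b2: "\<And>x c c'. b x (c + c') = b x c + b x c'"
    and im: "\<And>x c. b x c \<in> prime_field2"
  shows "card C * card {x\<in>A. \<forall>c\<in>C. b x c = 0} = card A * card {c\<in>C. \<forall>x\<in>A. b x c = 0}"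
proof -
  have count: "2 * card {p\<in>X \<times> Y. g (fst p) (snd p) = 0} =
      card Y * card X + card Y * card {x\<in>X. \<forall>y\<in>Y. g x y = 0}"
    if X: "subspace_over prime_field2 X" and Y: "subspace_over prime_field2 Y"
      and g: "\<And>x y y'. g x (y + y') = g x y + g x y'" and im': "\<And>x y. g x y \<in> prime_field2"
    for X Y :: "'a set" and g :: "'a \<Rightarrow> 'a \<Rightarrow> 'a"
  proof -
    have "{p\<in>X \<times> Y. g (fst p) (snd p) = 0} = Sigma X (\<lambda>x. {y\<in>Y. g x y = 0})" by auto
    then have "2 * card {p\<in>X \<times> Y. g (fst p) (snd p) = 0} = (\<Sum>x\<in>X. 2 * card {y\<in>Y. g x y = 0})"
      by (simp add: sum_distrib_left)
    \<comment> \<open>The slice over x is all of \<open>Y\<close> if x annihilates \<open>Y\<close>,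
      and half of \<open>Y\<close> otherwise.\<close>
    also have "\<dots> = (\<Sum>x\<in>X. card Y + (if \<forall>y\<in>Y. g x y = 0 then card Y else 0))"
    proof (intro sum.cong refl)
      fix x
      show "2 * card {y\<in>Y. g x y = 0} = card Y + (if \<forall>y\<in>Y. g x y = 0 then card Y else 0)"
        using card_kernel_half[OF Y, of "g x"] g im' by (auto split: if_splits)
    qed
    also have "\<dots> = card Y * card X + card Y * card {x\<in>X. \<forall>y\<in>Y. g x y = 0}"
      by (simp add: sum.distrib sum.inter_filter[symmetric])
    finally show ?thesis .
  qed
  have "bij_betw prod.swap {p\<in>A \<times> C. b (fst p) (snd p) = 0} {p\<in>C \<times> A. b (snd p) (fst p) = 0}"
    by (rule bij_betw_byWitness[of _ prod.swap]) auto
  then have "card {p\<in>A \<times> C. b (fst p) (snd p) = 0} = card {p\<in>C \<times> A. b (snd p) (fst p) = 0}"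
    by (rule bij_betw_same_card)
  moreover have "2 * card {p\<in>A \<times> C. b (fst p) (snd p) = 0} =
      card C * card A + card C * card {x\<in>A. \<forall>c\<in>C. b x c = 0}"
    by (rule count[OF A C]) (simp_all add: b2 im)
  moreover have "2 * card {p\<in>C \<times> A. b (snd p) (fst p) = 0} =
      card A * card C + card A * card {c\<in>C. \<forall>x\<in>A. b x c = 0}"
    using count[OF C A, of "\<lambda>c x. b x c"] by (simp add: b1 im)
  ultimately show ?thesis by simp
qed

lemma dual_family_indep:
  fixes v w :: "nat \<Rightarrow> 'a"
  assumes "\<forall>i\<in>{1..n}. \<forall>j\<in>{1..n}. tr (w i * v j) = (if i = j then 1 else 0)"
  shows "lin_indep_over prime_field2 n v"
  unfolding lin_indep_over_def
proof (intro allI impI ballI)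
  fix c i assume c: "\<forall>i\<in>{1..n}. c i \<in> prime_field2" and s: "(\<Sum>j=1..n. c j * v j) = 0"
    and i: "i \<in> {1..n}"
  have "0 = tr (w i * (\<Sum>j=1..n. c j * v j))" by (simp only: s mult_zero_right tr_0)
  also have "\<dots> = (\<Sum>j=1..n. tr (c j * (w i * v j)))"
    by (simp add: sum_distrib_left tr_sum ac_simps)
  also have "\<dots> = (\<Sum>j=1..n. if i = j then c j else 0)"
    using c i assms by (intro sum.cong) (auto simp: tr_scale)
  also have "\<dots> = c i" using i by simp
  finally show "c i = 0" by simp
qed

text \<open>Trace coordinates are 0 or 1, so their support determines them. Nondegeneracy makes the
  map injective, and both sides have 2^l elements.\<close>

lemma coordinates_bij:
  fixes v :: "nat \<Rightarrow> 'a"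
  assumes "lin_indep_over prime_field2 l v"
  shows "bij_betw (\<lambda>x. {j\<in>{1..l}. tr (x * v j) \<noteq> 0}) UNIV (Pow {1..l})"
proof -
  have sp: "span_over prime_field2 l v = UNIV"
    using basis2I[OF assms] by (simp add: basis_over_def)
  have "inj (\<lambda>x. {j\<in>{1..l}. tr (x * v j) \<noteq> 0})"
  proof (rule injI)
    fix x y assume eq: "{j\<in>{1..l}. tr (x * v j) \<noteq> 0} = {j\<in>{1..l}. tr (y * v j) \<noteq> 0}"
    have j: "tr ((x + y) * v j) = 0" if "j \<in> {1..l}" for j
    proof -
      have "tr (x * v j) \<noteq> 0 \<longleftrightarrow> tr (y * v j) \<noteq> 0" using eq that by blast
      then have "tr (x * v j) = tr (y * v j)" using tr_cases by metis
      then show ?thesis by (simp add: distrib_right tr_add)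
    qed
    have "tr ((x + y) * z) = 0" for z
    proof -
      obtain c where c: "\<forall>i\<in>{1..l}. c i \<in> prime_field2" "z = (\<Sum>i=1..l. c i * v i)"
        using sp unfolding span_over_def by blast
      have "tr ((x + y) * z) = (\<Sum>i=1..l. tr (c i * ((x + y) * v i)))"
        unfolding c(2) sum_distrib_left tr_sum by (intro sum.cong refl arg_cong[of _ _ tr]) (simp add: ac_simps)
      also have "\<dots> = 0" using c(1) j by (intro sum.neutral) (auto simp: tr_scale)
      finally show ?thesis .
    qed
    then have "x + y = 0" by (rule tr_nondegenerate)
    then show "x = y" by (simp add: add_eq_0_iff_eq)
  qed
  moreover have "range (\<lambda>x. {j\<in>{1..l}. tr (x * v j) \<noteq> 0}) = Pow {1..l}"
  proof (rule card_subset_eq)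
    show "card (range (\<lambda>x. {j\<in>{1..l}. tr (x * v j) \<noteq> 0})) = card (Pow {1..l})"
      using calculation by (simp add: card_image card_UNIV card_Pow)
  qed auto
  ultimately show ?thesis by (simp add: bij_betw_def)
qed

text \<open>The dual vector \<open>w i\<close> is the element whose support of trace coordinates is
  the singleton {i}.\<close>

lemma dual_family_exists:
  fixes v :: "nat \<Rightarrow> 'a"
  assumes "lin_indep_over prime_field2 l v"
  obtains w where "\<forall>i\<in>{1..l}. \<forall>j\<in>{1..l}. tr (w i * v j) = (if i = j then 1 else 0)"
proof -
  have "\<exists>x. {j\<in>{1..l}. tr (x * v j) \<noteq> 0} = {i}" if "i \<in> {1..l}" for i
  proof -
    have "{i} \<in> Pow {1..l}" using that by simp
    then show ?thesis using coordinates_bij[OF assms] unfolding bij_betw_def by (metis (no_types, lifting) imageE)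
  qed
  then obtain w where w: "\<And>i. i \<in> {1..l} \<Longrightarrow> {j\<in>{1..l}. tr (w i * v j) \<noteq> 0} = {i}"
    by metis
  have "tr (w i * v j) = (if i = j then 1 else 0)" if "i \<in> {1..l}" "j \<in> {1..l}" for i j
    using w[OF that(1)] that(2) tr_cases[of "w i * v j"] by auto
  then show ?thesis using that by blast
qed

text \<open>Under the coordinate bijection the annihilator becomes the family of supports disjoint
  from \<open>T\<close>.\<close>

lemma card_trace_annihilator:
  fixes v :: "nat \<Rightarrow> 'a"
  assumes ind: "lin_indep_over prime_field2 l v" and T: "T \<subseteq> {1..l}"
  shows "card {x. \<forall>j\<in>T. tr (x * v j) = 0} = 2 ^ (l - card T)"
proof -
  let ?f = "\<lambda>x. {j\<in>{1..l}. tr (x * v j) \<noteq> 0}"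
  have bij: "inj ?f" "range ?f = Pow {1..l}" using coordinates_bij[OF ind] by (auto simp: bij_betw_def)
  have "?f ` {x. \<forall>j\<in>T. tr (x * v j) = 0} = Pow ({1..l} - T)"
  proof (intro equalityI subsetI)
    fix J assume J: "J \<in> Pow ({1..l} - T)"
    then have "J \<in> range ?f" unfolding bij(2) by auto
    then obtain x where x: "J = ?f x" by (rule rangeE)
    have "tr (x * v j) = 0" if j: "j \<in> T" for j
    proof (rule ccontr)
      assume "tr (x * v j) \<noteq> 0"
      then have "j \<in> J" using x j T by auto
      then show False using J j by auto
    qed
    then show "J \<in> ?f ` {x. \<forall>j\<in>T. tr (x * v j) = 0}" unfolding x by (intro imageI) simp
  qed auto
  then have "card {x. \<forall>j\<in>T. tr (x * v j) = 0} = card (Pow ({1..l} - T))"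
    using card_image[OF inj_on_subset[OF bij(1) subset_UNIV], of "{x. \<forall>j\<in>T. tr (x * v j) = 0}"]
    by simp
  also have "\<dots> = 2 ^ (l - card T)"
    using T by (simp add: card_Pow card_Diff_subset finite_subset)
  finally show ?thesis .
qed

lemma basis2_nonzero:
  fixes v :: "nat \<Rightarrow> 'a"
  assumes "lin_indep_over prime_field2 n v" "i \<in> {1..n}"
  shows "v i \<noteq> 0"
proof
  assume v: "v i = 0"
  define c :: "nat \<Rightarrow> 'a" where "c j = (if j = i then 1 else 0)" for j
  have "(\<Sum>j=1..n. c j * v j) = 0" using v by (intro sum.neutral) (simp add: c_def)
  moreover have "\<forall>j\<in>{1..n}. c j \<in> prime_field2" by (simp add: c_def prime_field2_def)
  ultimately have "c i = 0" using assms unfolding lin_indep_over_def by blast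
  then show False by (simp add: c_def)
qed

lemma scaled_trace_ker_eq:
  assumes "b \<noteq> 0"
  shows "scaled_trace_ker l b = {y. tr (b * y) = 0}"
proof (intro equalityI subsetI)
  fix y assume "y \<in> {y. tr (b * y) = 0}"
  then have "y = inverse b * (b * y)" "b * y \<in> {x. tr x = 0}" using assms by auto
  then show "y \<in> scaled_trace_ker l b" unfolding scaled_trace_ker_def by blast
qed (use assms in \<open>auto simp: scaled_trace_ker_def simp flip: mult.assoc\<close>)

end

section \<open>Intersections of subspaces and expansion in dual bases\<close>

context binary_field
begin

text \<open>Addition maps the product of \<open>V\<close> and \<open>W\<close> into the field of
  size 2^l; translating by one point embeds each fibre into the intersection.\<close>

lemma card_subspace_Int:
  assumes V: "subspace_over (prime_field2 :: 'a set) V" and W: "subspace_over prime_field2 W"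
  shows "card V * card W \<le> 2 ^ l * card (V \<inter> W)"
proof -
  have fib: "card {p\<in>V \<times> W. fst p + snd p = z} \<le> card (V \<inter> W)" for z
  proof (cases "{p\<in>V \<times> W. fst p + snd p = z} = {}")
    case True
    then show ?thesis by (simp only: True card.empty)
  next
    case False
    then obtain x0 y0 where 0: "x0 \<in> V" "y0 \<in> W" "x0 + y0 = z" by auto
    show ?thesis
    proof (rule card_inj_on_le[where f = "\<lambda>p. fst p + x0"])
      show "inj_on (\<lambda>p. fst p + x0) {p\<in>V \<times> W. fst p + snd p = z}"
        by (auto simp: inj_on_def)
      have "x + x0 \<in> V \<inter> W" if "x \<in> V" "y \<in> W" "x + y = z" for x y
      proof -
        have "x + x0 + (y + y0) = 0" using 0(3) that(3) by (metis add.commute add.left_commute add_self)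
        then have "x + x0 = y + y0" by (simp only: add_eq_0_iff_eq)
        then show ?thesis using 0 that V W unfolding subspace2_iff by (metis IntI)
      qed
      then show "(\<lambda>p. fst p + x0) ` {p\<in>V \<times> W. fst p + snd p = z} \<subseteq> V \<inter> W" by auto
    qed simp
  qed
  have "card (V \<times> W) = (\<Sum>z\<in>UNIV. card {p\<in>V \<times> W. fst p + snd p = z})"
    using sum.group[of "V \<times> W" UNIV "\<lambda>p. fst p + snd p" "\<lambda>_. 1::nat"] by simp
  also have "\<dots> \<le> (\<Sum>z\<in>(UNIV::'a set). card (V \<inter> W))" by (intro sum_mono fib)
  finally show ?thesis by (simp add: card_UNIV card_cartesian_product)
qed

text \<open>With \<open>r \<nu>\<close> read as the codimension of \<open>V \<nu>\<close>, this is
  subadditivity of codimension, by iterating the bound for two subspaces.\<close>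

lemma card_subspace_INT:
  fixes V :: "nat \<Rightarrow> 'a set"
  assumes "finite S" "\<And>\<nu>. \<nu> \<in> S \<Longrightarrow> subspace_over prime_field2 (V \<nu>)"
    and "\<And>\<nu>. \<nu> \<in> S \<Longrightarrow> card (V \<nu>) * 2 ^ r \<nu> = 2 ^ l"
  shows "2 ^ l \<le> card (\<Inter>\<nu>\<in>S. V \<nu>) * 2 ^ (\<Sum>\<nu>\<in>S. r \<nu>)"
  using assms
proof (induction S rule: finite_induct)
  case empty
  then show ?case by (simp add: card_UNIV)
next
  case (insert \<nu> S)
  let ?I = "\<Inter>\<nu>\<in>S. V \<nu>"
  have I: "subspace_over prime_field2 ?I"
    using insert.prems(1) by (simp add: subspace2_iff)
  have "2 ^ l * 2 ^ l \<le> (card (V \<nu>) * 2 ^ r \<nu>) * (card ?I * 2 ^ (\<Sum>\<nu>\<in>S. r \<nu>))"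
    using insert.IH insert.prems by simp
  also have "\<dots> = (card (V \<nu>) * card ?I) * (2 ^ r \<nu> * 2 ^ (\<Sum>\<nu>\<in>S. r \<nu>))"
    by (simp only: ac_simps)
  also have "\<dots> \<le> (2 ^ l * card (V \<nu> \<inter> ?I)) * (2 ^ r \<nu> * 2 ^ (\<Sum>\<nu>\<in>S. r \<nu>))"
    using card_subspace_Int[OF insert.prems(1)[of \<nu>] I] by (intro mult_right_mono) auto
  also have "\<dots> = 2 ^ l * (card (V \<nu> \<inter> ?I) * 2 ^ (\<Sum>\<nu>\<in>insert \<nu> S. r \<nu>))"
    using insert.hyps by (simp add: power_add)
  finally show ?case by simp
qed

text \<open>The sums over the subsets of \<open>S\<close> are pairwise distinct and all lie in
  \<open>V\<close>.\<close>

lemma card_ge_of_indep: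
  fixes v :: "nat \<Rightarrow> 'a"
  assumes ind: "lin_indep_over prime_field2 l v" and S: "S \<subseteq> {1..l}"
    and V: "subspace_over prime_field2 V" and SV: "\<And>i. i \<in> S \<Longrightarrow> v i \<in> V"
  shows "2 ^ card S \<le> card V"
proof -
  have fin: "finite S" using S finite_subset by blast
  have mem: "(\<Sum>i\<in>J. v i) \<in> V" if "J \<subseteq> S" for J
    using finite_subset[OF that fin] that
    by (induction J rule: finite_induct) (use V SV in \<open>auto simp: subspace2_iff\<close>)
  have "inj_on (\<lambda>J. \<Sum>i\<in>J. v i) (Pow S)"
  proof (rule inj_onI)
    fix J J' assume J: "J \<in> Pow S" "J' \<in> Pow S" and eq: "(\<Sum>i\<in>J. v i) = (\<Sum>i\<in>J'. v i)"
    \<comment> \<open>Since 1 + 1 = 0, this is the indicator of the symmetric difference of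
      \<open>J\<close> and \<open>J'\<close>.\<close>
    define c :: "nat \<Rightarrow> 'a" where "c i = (if i \<in> J then 1 else 0) + (if i \<in> J' then 1 else 0)" for i
    have sub: "(\<Sum>i=1..l. (if i \<in> J then 1 else 0) * v i) = (\<Sum>i\<in>J. v i)" if "J \<in> Pow S" for J
    proof -
      have "{1..l} \<inter> J = J" using that S by auto
      moreover have "(\<Sum>i=1..l. (if i \<in> J then 1 else 0) * v i) = (\<Sum>i=1..l. if i \<in> J then v i else 0)"
        by (intro sum.cong) auto
      ultimately show ?thesis using sum.inter_restrict[of "{1..l}" v J] by simp
    qed
    have "(\<Sum>i=1..l. c i * v i) = 0"
      using eq unfolding c_def distrib_right sum.distrib sub[OF J(1)] sub[OF J(2)] by simp
    moreover have "\<forall>i\<in>{1..l}. c i \<in> prime_field2" by (simp add: c_def prime_field2_def)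
    ultimately have c0: "\<forall>i\<in>{1..l}. c i = 0" using ind unfolding lin_indep_over_def by blast
    have "i \<in> J \<longleftrightarrow> i \<in> J'" if "i \<in> S" for i
    proof -
      have "c i = 0" using c0 that S by blast
      then show ?thesis by (auto simp: c_def split: if_splits)
    qed
    then show "J = J'" using J by blast
  qed
  moreover have "(\<lambda>J. \<Sum>i\<in>J. v i) ` Pow S \<subseteq> V" using mem by blast
  ultimately have "card (Pow S) \<le> card V" by (intro card_inj_on_le) auto
  then show ?thesis using fin by (simp add: card_Pow)
qed

lemma dual_expansion:
  fixes v w :: "nat \<Rightarrow> 'a"
  assumes v: "lin_indep_over prime_field2 l v"
    and dual: "\<forall>i\<in>{1..l}. \<forall>j\<in>{1..l}. tr (w i * v j) = (if i = j then 1 else 0)"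
  shows "x = (\<Sum>j=1..l. tr (x * w j) * v j)"
proof -
  have "x \<in> span_over prime_field2 l v" using basis2I[OF v] by (simp add: basis_over_def)
  then obtain c where c: "\<forall>i\<in>{1..l}. c i \<in> prime_field2" "x = (\<Sum>i=1..l. c i * v i)"
    unfolding span_over_def by blast
  have "tr (x * w i) = c i" if i: "i \<in> {1..l}" for i
  proof -
    have "tr (x * w i) = (\<Sum>j=1..l. tr (c j * (w i * v j)))"
      unfolding c(2) sum_distrib_right tr_sum by (intro sum.cong refl arg_cong[of _ _ tr]) (simp add: ac_simps)
    also have "\<dots> = (\<Sum>j=1..l. if i = j then c j else 0)"
      using c(1) i dual by (intro sum.cong) (auto simp: tr_scale)
    finally show ?thesis using i by simp
  qed
  then have "(\<Sum>j=1..l. tr (x * w j) * v j) = (\<Sum>j=1..l. c j * v j)" by (intro sum.cong) auto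
  then show ?thesis using c(2) by simp
qed

section \<open>The lower bound on the I/O cost\<close>

lemma quadratic_zero_count:
  fixes P Q :: "'a \<Rightarrow> 'a" and \<beta> :: "nat \<Rightarrow> 'a"
  assumes A: "subspace_over prime_field2 A" "card A = 2 ^ d" "d \<le> l"
    and P: "\<And>c c'. P (c + c') = P c + P c'" and Q: "\<And>c c'. Q (c + c') = Q c + Q c'"
    and \<beta>: "lin_indep_over prime_field2 l \<beta>"
  shows "(\<Sum>\<nu>=1..l. card {x\<in>A. \<forall>c. tr ((c + P c * x + Q c * x\<^sup>2) * \<beta> \<nu>) = 0})
    \<le> (l - d + 2) * 2 ^ (d - 1)"
proof -
  define X where "X \<nu> = {x\<in>A. \<forall>c. tr ((c + P c * x + Q c * x\<^sup>2) * \<beta> \<nu>) = 0}" for \<nu>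
  \<comment> \<open>\<open>b \<nu>\<close> is the nonconstant part of column \<open>\<nu>\<close>,
    biadditive in the node x and the value c; \<open>K \<nu>\<close> and \<open>V \<nu>\<close> are
    its left and right kernels. \<open>T\<close> collects the columns that vanish at some
    node.\<close>
  define b where "b \<nu> x c = tr ((P c * x + Q c * x\<^sup>2) * \<beta> \<nu>)" for \<nu> x c
  define K where "K \<nu> = {x\<in>A. \<forall>c. b \<nu> x c = 0}" for \<nu>
  define V where "V \<nu> = {c. \<forall>x\<in>A. b \<nu> x c = 0}" for \<nu>
  define T where "T = {\<nu>\<in>{1..l}. X \<nu> \<noteq> {}}"
  have b1: "b \<nu> (x + x') c = b \<nu> x c + b \<nu> x' c" for \<nu> x x' c
    unfolding b_def by (simp add: square_add algebra_simps flip: tr_add)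
  have b2: "b \<nu> x (c + c') = b \<nu> x c + b \<nu> x c'" for \<nu> x c c'
    unfolding b_def by (simp add: P Q algebra_simps flip: tr_add)
  have bX: "x \<in> X \<nu> \<longleftrightarrow> x \<in> A \<and> (\<forall>c. tr (c * \<beta> \<nu>) = b \<nu> x c)" for x \<nu>
  proof -
    have "tr ((c + P c * x + Q c * x\<^sup>2) * \<beta> \<nu>) = tr (c * \<beta> \<nu>) + b \<nu> x c" for c
      unfolding b_def by (simp add: algebra_simps flip: tr_add)
    then show ?thesis unfolding X_def by (simp add: add_eq_0_iff_eq)
  qed
  have UNIVs: "subspace_over prime_field2 (UNIV :: 'a set)" by (simp add: subspace2_iff)
  have b0: "b \<nu> 0 c = 0" "b \<nu> x 0 = 0" for \<nu> x c using b1[of \<nu> 0 0 c] b2[of \<nu> x 0 0] by simp_all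
  have Ks: "subspace_over prime_field2 (K \<nu>)" for \<nu>
    using A(1) by (auto simp: subspace2_iff K_def b1 b0)
  have Vs: "subspace_over prime_field2 (V \<nu>)" for \<nu>
    by (auto simp: subspace2_iff V_def b2 b0)
  have KV: "2 ^ l * card (K \<nu>) = 2 ^ d * card (V \<nu>)" for \<nu>
  proof -
    have "card (UNIV :: 'a set) * card {x\<in>A. \<forall>c\<in>UNIV. b \<nu> x c = 0} = card A * card {c\<in>UNIV. \<forall>x\<in>A. b \<nu> x c = 0}"
      by (rule card_annihilators[OF A(1) UNIVs]) (simp_all add: b1 b2, simp add: b_def tr_in)
    then show ?thesis by (simp add: card_UNIV A(2) K_def V_def)
  qed
  have "\<exists>k. card (K \<nu>) = 2 ^ k" for \<nu> using card_subspace_power[OF Ks] by metis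
  then obtain k where k: "\<And>\<nu>. card (K \<nu>) = 2 ^ k \<nu>" by metis
  have kd: "k \<nu> \<le> d" for \<nu>
  proof -
    have "card (K \<nu>) \<le> card A" by (intro card_mono) (auto simp: K_def)
    then show ?thesis by (simp add: k A(2))
  qed
  \<comment> \<open>The two kernels of a bilinear form have equal codimension, so
    \<open>r \<nu>\<close> serves both for \<open>K \<nu>\<close> in \<open>A\<close> and for
    \<open>V \<nu>\<close> in the field.\<close>
  define r where "r \<nu> = d - k \<nu>" for \<nu>
  have Vr: "card (V \<nu>) * 2 ^ r \<nu> = 2 ^ l" for \<nu>
  proof -
    have "2 ^ k \<nu> * (card (V \<nu>) * 2 ^ r \<nu>) = (2 ^ (k \<nu> + r \<nu>)) * card (V \<nu>)"
      by (simp only: power_add ac_simps)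
    also have "k \<nu> + r \<nu> = d" using kd by (simp add: r_def)
    also have "2 ^ d * card (V \<nu>) = 2 ^ k \<nu> * 2 ^ l" using KV[of \<nu>] by (simp add: k mult.commute)
    finally show ?thesis by simp
  qed
  \<comment> \<open>At a node x0 where the column vanishes, tr(c * \<open>\<beta> \<nu>\<close>)
    equals \<open>b \<nu> x0 c\<close>, which is 0 on \<open>V \<nu>\<close>.\<close>
  have VH: "tr (c * \<beta> \<nu>) = 0" if \<nu>: "\<nu> \<in> T" and c: "c \<in> V \<nu>" for \<nu> c
  proof -
    obtain x0 where "x0 \<in> X \<nu>" using \<nu> unfolding T_def by auto
    then show ?thesis using c bX[of x0 \<nu>] by (simp add: V_def)
  qed
  have r1: "1 \<le> r \<nu>" if \<nu>: "\<nu> \<in> T" for \<nu>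
  proof (rule ccontr)
    assume "\<not> 1 \<le> r \<nu>"
    then have "r \<nu> = 0" by simp
    then have "card (V \<nu>) = card (UNIV :: 'a set)" using Vr[of \<nu>] by (simp add: card_UNIV)
    then have "V \<nu> = UNIV" by (simp add: card_subset_eq)
    then have "tr (\<beta> \<nu> * c) = 0" for c using VH[OF \<nu>, of c] by (simp add: mult.commute)
    then have "\<beta> \<nu> = 0" by (rule tr_nondegenerate)
    then show False using basis2_nonzero[OF \<beta>] \<nu> by (auto simp: T_def)
  qed
  \<comment> \<open>Two nodes with vanishing column \<open>\<nu>\<close> differ by an element of
    \<open>K \<nu>\<close>.\<close>
  have XK: "card (X \<nu>) \<le> 2 ^ (d - r \<nu>)" if \<nu>: "\<nu> \<in> T" for \<nu>
  proof -
    obtain x0 where x0: "x0 \<in> X \<nu>" using \<nu> unfolding T_def by auto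
    have "x + x0 \<in> K \<nu>" if x: "x \<in> X \<nu>" for x
    proof -
      have "b \<nu> (x + x0) c = 0" for c using x x0 bX[of x \<nu>] bX[of x0 \<nu>] unfolding b1 by (metis add_self)
      moreover have "x + x0 \<in> A" using x x0 A(1) bX by (simp add: subspace2_iff)
      ultimately show ?thesis by (simp add: K_def)
    qed
    then have "card (X \<nu>) \<le> card (K \<nu>)"
      by (intro card_inj_on_le[where f = "\<lambda>x. x + x0"]) auto
    then show ?thesis using kd[of \<nu>] by (simp add: k r_def)
  qed
  \<comment> \<open>Otherwise the quadratic without constant term has at most two zeros in
    \<open>A\<close>, and duality bounds the annihilator \<open>N\<close> of its values by
    2^(l-d+1). But \<open>N\<close> contains l-d+2 independent elements
    \<open>\<beta> \<nu>\<close>.\<close>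
  have const: "P c = 0 \<and> Q c = 0"
    if S: "S \<subseteq> {1..l}" "card S = l - d + 2" and c: "\<And>\<nu>. \<nu> \<in> S \<Longrightarrow> c \<in> V \<nu>" for S c
  proof (rule ccontr)
    assume nz: "\<not> (P c = 0 \<and> Q c = 0)"
    define N where "N = {y. \<forall>x\<in>A. tr ((P c * x + Q c * x\<^sup>2) * y) = 0}"
    have eq: "card (UNIV :: 'a set) * card {x\<in>A. \<forall>y\<in>UNIV. tr ((P c * x + Q c * x\<^sup>2) * y) = 0} =
        card A * card {y\<in>UNIV. \<forall>x\<in>A. tr ((P c * x + Q c * x\<^sup>2) * y) = 0}"
      by (rule card_annihilators[OF A(1) UNIVs])
        (simp_all add: tr_in square_add algebra_simps flip: tr_add)
    have "{x\<in>A. \<forall>y\<in>UNIV. tr ((P c * x + Q c * x\<^sup>2) * y) = 0} \<subseteq> {x. poly [:0, P c, Q c:] x = 0}"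
    proof
      fix x assume x: "x \<in> {x\<in>A. \<forall>y\<in>UNIV. tr ((P c * x + Q c * x\<^sup>2) * y) = 0}"
      have "P c * x + Q c * x\<^sup>2 = 0"
        by (rule tr_nondegenerate) (use x in blast)
      then show "x \<in> {x. poly [:0, P c, Q c:] x = 0}"
        by (simp add: algebra_simps power2_eq_square)
    qed
    then have "card {x\<in>A. \<forall>y\<in>UNIV. tr ((P c * x + Q c * x\<^sup>2) * y) = 0} \<le> card {x. poly [:0, P c, Q c:] x = 0}"
      by (intro card_mono) auto
    also have "\<dots> \<le> degree [:0, P c, Q c:]" using nz by (intro card_poly_roots_bound) auto
    also have "\<dots> \<le> 2" by simp
    finally have "2 ^ l * card {x\<in>A. \<forall>y\<in>UNIV. tr ((P c * x + Q c * x\<^sup>2) * y) = 0} \<le> 2 ^ l * 2"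
      by (rule mult_le_mono2)
    moreover have "2 ^ l * card {x\<in>A. \<forall>y\<in>UNIV. tr ((P c * x + Q c * x\<^sup>2) * y) = 0} = 2 ^ d * card N"
      using eq by (simp add: N_def card_UNIV A(2))
    ultimately have "2 ^ d * card N \<le> 2 ^ l * 2" by (simp only:)
    moreover have "subspace_over prime_field2 N"
      by (auto simp: subspace2_iff N_def distrib_left tr_add)
    then have "2 ^ card S \<le> card N"
      by (rule card_ge_of_indep[OF \<beta> S(1)]) (use c in \<open>auto simp: N_def V_def b_def\<close>)
    ultimately have "2 ^ d * 2 ^ (l - d + 2) \<le> (2::nat) ^ l * 2"
      unfolding S(2) by (meson le_trans mult_le_mono2)
    moreover have "2 ^ d * 2 ^ (l - d + 2) = (2::nat) ^ l * 4"
    proof -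
      have "d + (l - d + 2) = l + 2" using A(3) by simp
      then have "2 ^ d * 2 ^ (l - d + 2) = (2::nat) ^ (l + 2)" by (metis power_add)
      then show ?thesis by (simp add: power_add)
    qed
    ultimately show False by simp
  qed
  have "(\<Sum>\<nu>\<in>T. 2 ^ (d - r \<nu>)) \<le> (l - d + 2) * (2::nat) ^ (d - 1)"
  proof (rule sum_halving_powers_le)
    show "finite T" by (simp add: T_def)
    show "1 \<le> r \<nu> \<and> r \<nu> \<le> d" if "\<nu> \<in> T" for \<nu> using r1[OF that] by (simp add: r_def)
    fix S assume S: "S \<subseteq> T" "card S = l - d + 2"
    have Tl: "T \<subseteq> {1..l}" by (auto simp: T_def)
    then have Sl: "S \<subseteq> {1..l}" using S(1) by blast
    \<comment> \<open>Once \<open>P c\<close> and \<open>Q c\<close> vanish, \<open>b\<close>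
      vanishes at c for every column, so c is annihilated by all of \<open>T\<close> and not just by
      \<open>S\<close>. Comparing codimensions then bounds \<open>card T\<close>.\<close>
    have "(\<Inter>\<nu>\<in>S. V \<nu>) \<subseteq> {c. \<forall>\<nu>\<in>T. tr (c * \<beta> \<nu>) = 0}"
    proof
      fix c assume "c \<in> (\<Inter>\<nu>\<in>S. V \<nu>)"
      then have "P c = 0" "Q c = 0" using const[OF Sl S(2)] by auto
      then have "c \<in> V \<nu>" for \<nu> by (simp add: V_def b_def)
      then show "c \<in> {c. \<forall>\<nu>\<in>T. tr (c * \<beta> \<nu>) = 0}" using VH by blast
    qed
    then have "card (\<Inter>\<nu>\<in>S. V \<nu>) \<le> card {c. \<forall>\<nu>\<in>T. tr (c * \<beta> \<nu>) = 0}" by (intro card_mono) auto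
    also have "\<dots> = 2 ^ (l - card T)" by (rule card_trace_annihilator[OF \<beta> Tl])
    finally have "card (\<Inter>\<nu>\<in>S. V \<nu>) * 2 ^ (\<Sum>\<nu>\<in>S. r \<nu>) \<le> 2 ^ (l - card T) * 2 ^ (\<Sum>\<nu>\<in>S. r \<nu>)"
      by simp
    moreover have "2 ^ l \<le> card (\<Inter>\<nu>\<in>S. V \<nu>) * 2 ^ (\<Sum>\<nu>\<in>S. r \<nu>)"
      by (rule card_subspace_INT) (use finite_subset[OF Sl] Vs Vr in auto)
    ultimately have "(2::nat) ^ l \<le> 2 ^ (l - card T + (\<Sum>\<nu>\<in>S. r \<nu>))"
      unfolding power_add by linarith
    then have "l \<le> l - card T + (\<Sum>\<nu>\<in>S. r \<nu>)" by simp
    moreover have "card T \<le> l" using card_mono[OF _ Tl] by simp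
    ultimately show "card T \<le> (\<Sum>\<nu>\<in>S. r \<nu>)" by linarith
  qed
  moreover have "(\<Sum>\<nu>\<in>T. card (X \<nu>)) \<le> (\<Sum>\<nu>\<in>T. 2 ^ (d - r \<nu>))" by (intro sum_mono XK)
  moreover have "(\<Sum>\<nu>=1..l. card (X \<nu>)) = (\<Sum>\<nu>\<in>T. card (X \<nu>))"
    by (intro sum.mono_neutral_right) (auto simp: T_def)
  ultimately show ?thesis by (simp add: X_def)
qed

text \<open>Reduction to the preceding bound: translate the failed node to 0 and replace the list
  \<open>g\<close> by its linear combinations, indexed by their value c at \<open>a\<close>.\<close>

lemma scheme_zero_count:
  fixes A :: "'a set" and \<beta> :: "nat \<Rightarrow> 'a"
  assumes A: "subspace_over prime_field2 A" "card A = 2 ^ d" "d \<le> l" and a: "a \<in> A"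
    and deg: "\<And>j. j \<in> {1..l} \<Longrightarrow> degree (g j) \<le> 2"
    and ind: "lin_indep_over prime_field2 l (\<lambda>j. poly (g j) a)"
    and \<beta>: "lin_indep_over prime_field2 l \<beta>"
  shows "(\<Sum>\<nu>=1..l. card {x\<in>A - {a}. \<forall>j\<in>{1..l}. tr (poly (g j) x * \<beta> \<nu>) = 0})
    \<le> (l - d + 2) * 2 ^ (d - 1)"
proof -
  obtain w where w: "\<forall>i\<in>{1..l}. \<forall>j\<in>{1..l}. tr (w i * poly (g j) a) = (if i = j then 1 else 0)"
    by (rule dual_family_exists[OF ind])
  \<comment> \<open>tr(c * \<open>w j\<close>) is the coordinate of c at the basis vector
    \<open>poly (g j) a\<close>, so combining the \<open>g j\<close> with these coefficients gives
    the polynomial with value c at \<open>a\<close>.\<close>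
  define P where "P c = (\<Sum>j=1..l. tr (c * w j) * coeff (g j) 1)" for c
  define Q where "Q c = (\<Sum>j=1..l. tr (c * w j) * coeff (g j) 2)" for c
  \<comment> \<open>Squaring is additive, so translation by \<open>a\<close> leaves the coefficients
    of degrees 1 and 2 unchanged.\<close>
  have shift: "poly (g j) (x + a) = poly (g j) a + coeff (g j) 1 * x + coeff (g j) 2 * x\<^sup>2"
    if "j \<in> {1..l}" for j x
  proof -
    have p: "poly (g j) y = coeff (g j) 0 + coeff (g j) 1 * y + coeff (g j) 2 * y\<^sup>2" for y
    proof -
      have "poly (g j) y = (\<Sum>i\<le>2. coeff (g j) i * y ^ i)" unfolding poly_altdef
        by (intro sum.mono_neutral_left) (use deg[OF that] in \<open>auto simp: coeff_eq_0\<close>)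
      then show ?thesis by (simp add: numeral_2_eq_2)
    qed
    show ?thesis unfolding p[of "x + a"] p[of a] by (simp add: square_add algebra_simps)
  qed
  have comb: "c + P c * x + Q c * x\<^sup>2 = (\<Sum>j=1..l. tr (c * w j) * poly (g j) (x + a))" for c x
  proof -
    have "(\<Sum>j=1..l. tr (c * w j) * poly (g j) (x + a)) = (\<Sum>j=1..l. tr (c * w j) * poly (g j) a
        + tr (c * w j) * coeff (g j) 1 * x + tr (c * w j) * coeff (g j) 2 * x\<^sup>2)"
      by (intro sum.cong refl) (simp only: shift distrib_left mult.assoc)
    also have "\<dots> = (\<Sum>j=1..l. tr (c * w j) * poly (g j) a) + P c * x + Q c * x\<^sup>2"
      by (simp add: P_def Q_def sum.distrib sum_distrib_right)
    also have "(\<Sum>j=1..l. tr (c * w j) * poly (g j) a) = c"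
      by (rule dual_expansion[OF ind w, symmetric])
    finally show ?thesis by simp
  qed
  \<comment> \<open>A column that vanishes for every \<open>g j\<close> vanishes for all their
    combinations, at the node translated by \<open>a\<close>.\<close>
  have "card {x\<in>A - {a}. \<forall>j\<in>{1..l}. tr (poly (g j) x * \<beta> \<nu>) = 0} \<le>
      card {x\<in>A. \<forall>c. tr ((c + P c * x + Q c * x\<^sup>2) * \<beta> \<nu>) = 0}" for \<nu>
  proof (rule card_inj_on_le[where f = "\<lambda>x. x + a"])
    have "tr ((c + P c * (x + a) + Q c * (x + a)\<^sup>2) * \<beta> \<nu>) = 0"
      if x: "\<forall>j\<in>{1..l}. tr (poly (g j) x * \<beta> \<nu>) = 0" for x c
    proof -
      have "tr ((c + P c * (x + a) + Q c * (x + a)\<^sup>2) * \<beta> \<nu>) =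
          (\<Sum>j=1..l. tr (tr (c * w j) * (poly (g j) x * \<beta> \<nu>)))"
        unfolding comb sum_distrib_right tr_sum by (simp add: add.assoc mult.assoc)
      also have "\<dots> = 0" using x by (intro sum.neutral) (simp add: tr_scale[OF tr_in])
      finally show ?thesis .
    qed
    then show "(\<lambda>x. x + a) ` {x\<in>A - {a}. \<forall>j\<in>{1..l}. tr (poly (g j) x * \<beta> \<nu>) = 0}
        \<subseteq> {x\<in>A. \<forall>c. tr ((c + P c * x + Q c * x\<^sup>2) * \<beta> \<nu>) = 0}"
      using A(1) a by (auto simp: subspace2_iff)
  qed auto
  then have "(\<Sum>\<nu>=1..l. card {x\<in>A - {a}. \<forall>j\<in>{1..l}. tr (poly (g j) x * \<beta> \<nu>) = 0}) \<le>
      (\<Sum>\<nu>=1..l. card {x\<in>A. \<forall>c. tr ((c + P c * x + Q c * x\<^sup>2) * \<beta> \<nu>) = 0})"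
    by (intro sum_mono)
  also have "\<dots> \<le> (l - d + 2) * 2 ^ (d - 1)"
    by (rule quadratic_zero_count[OF A _ _ \<beta>])
      (simp_all add: P_def Q_def distrib_right tr_add sum.distrib)
  finally show ?thesis .
qed

end

text \<open>Double counting of the pairs of a helper node and a vanishing column. The additive form
  avoids truncated subtraction.\<close>

lemma io_cost_complement:
  assumes A: "finite A" "a \<in> A"
  shows "io_cost l A a g \<beta> +
      (\<Sum>\<nu>=1..l. card {x\<in>A - {a}. \<forall>j\<in>{1..l}. trace2 l (poly (g j) x * \<beta> \<nu>) = 0}) =
    (card A - 1) * l"
proof -
  define Z where "Z x \<nu> \<longleftrightarrow> (\<forall>j\<in>{1..l}. trace2 l (poly (g j) x * \<beta> \<nu>) = 0)" for x \<nu>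
  have "(\<Sum>\<nu>=1..l. card {x\<in>A - {a}. Z x \<nu>}) = (\<Sum>\<nu>=1..l. \<Sum>x\<in>A - {a}. if Z x \<nu> then 1 else 0)"
    using A(1) by (simp add: sum.inter_filter[symmetric])
  also have "\<dots> = (\<Sum>x\<in>A - {a}. \<Sum>\<nu>=1..l. if Z x \<nu> then 1 else 0)" by (rule sum.swap)
  also have "\<dots> = (\<Sum>x\<in>A - {a}. card {\<nu>\<in>{1..l}. Z x \<nu>})"
    by (simp add: sum.inter_filter[symmetric])
  finally have *: "(\<Sum>\<nu>=1..l. card {x\<in>A - {a}. Z x \<nu>}) = (\<Sum>x\<in>A - {a}. card {\<nu>\<in>{1..l}. Z x \<nu>})" .
  have "nz l (repair_matrix l g \<beta> x) + card {\<nu>\<in>{1..l}. Z x \<nu>} = l" for x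
  proof -
    have "{\<nu>\<in>{1..l}. \<exists>j\<in>{1..l}. repair_matrix l g \<beta> x j \<nu> \<noteq> 0} = {1..l} - {\<nu>\<in>{1..l}. Z x \<nu>}"
      by (auto simp: repair_matrix_def Z_def)
    moreover have "card {\<nu>\<in>{1..l}. Z x \<nu>} \<le> card {1..l}" by (intro card_mono) auto
    moreover have "card ({1..l} - {\<nu>\<in>{1..l}. Z x \<nu>}) = card {1..l} - card {\<nu>\<in>{1..l}. Z x \<nu>}"
      by (intro card_Diff_subset) auto
    ultimately show ?thesis unfolding nz_def by simp
  qed
  then have "io_cost l A a g \<beta> + (\<Sum>\<nu>=1..l. card {x\<in>A - {a}. Z x \<nu>}) = (\<Sum>x\<in>A - {a}. l)"
    unfolding io_cost_def * by (simp flip: sum.distrib)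
  then show ?thesis using A by (simp add: Z_def)
qed

text \<open>Matches the indexing (i-1)m + j of the product basis in the construction.\<close>

lemma sum_blocks:
  fixes f :: "nat \<Rightarrow> 'b::comm_monoid_add"
  shows "(\<Sum>t=1..n * m. f t) = (\<Sum>i=1..n. \<Sum>j=1..m. f ((i - 1) * m + j))"
proof (induction n)
  case (Suc n)
  have "(\<Sum>t=1..n * m + m. f t) = (\<Sum>t=1..n * m. f t) + (\<Sum>t=n * m + 1..n * m + m. f t)"
    by (rule sum.ub_add_nat) simp
  also have "(\<Sum>t=n * m + 1..n * m + m. f t) = (\<Sum>j=1..m. f (n * m + j))"
    using sum.shift_bounds_cl_nat_ivl[of f 1 "n * m" m] by (simp add: add.commute)
  finally show ?case using Suc by (simp add: add.commute)
qed simp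

context binary_field
begin

section \<open>Existence of the construction\<close>

lemma subfield_exists:
  assumes m: "m \<ge> 1" "m dvd l"
  obtains E :: "'a set" where "is_subfield E" "card E = 2 ^ m"
proof -
  define E :: "'a set" where "E = {x. x ^ (2 ^ m) = x}"
  define \<phi> :: "'a \<Rightarrow> 'a" where "\<phi> x = x ^ (2 ^ m) + x" for x
  obtain s where s: "l = m * s" using m by (elim dvdE)
  then have s1: "s \<ge> 1" using l_pos by (cases s) auto
  \<comment> \<open>The relative trace kills \<open>\<phi>\<close>; its degree bounds the range, hence the kernel \<open>E\<close> from below.\<close>
  define R :: "'a poly" where "R = (\<Sum>i<s. monom 1 (2 ^ (m * i)))"
  have R: "poly R x = (\<Sum>i<s. x ^ (2 ^ (m * i)))" for x
    by (simp add: R_def poly_sum poly_monom)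
  have E_eq: "E = {x. \<phi> x = 0}" by (simp add: E_def \<phi>_def add_eq_0_iff_eq)
  have \<phi>_add: "\<phi> (x + y) = \<phi> x + \<phi> y" for x y by (simp add: \<phi>_def frob_add ac_simps)
  have "poly R (\<phi> x) = 0" for x
  proof -
    have "poly R (\<phi> x) = (\<Sum>i<s. x ^ (2 ^ (m * Suc i))) + (\<Sum>i<s. x ^ (2 ^ (m * i)))"
      by (simp add: R \<phi>_def frob_add sum.distrib power_add flip: power_mult)
    \<comment> \<open>The shifted sum differs only in its end terms, x and x^(2^l), and these
      agree.\<close>
    moreover have "(\<Sum>i<s. x ^ (2 ^ (m * Suc i))) + x = (\<Sum>i<s. x ^ (2 ^ (m * i))) + x"
      using sum.lessThan_Suc_shift[of "\<lambda>i. x ^ (2 ^ (m * i))" s] power_card[of x]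
      by (simp add: s add.commute)
    ultimately show ?thesis by simp
  qed
  then have "range \<phi> \<subseteq> {x. poly R x = 0}" by auto
  then have "card (range \<phi>) \<le> card {x. poly R x = 0}" by (intro card_mono) auto
  also have "\<dots> \<le> degree R"
  proof (rule card_poly_roots_bound)
    have "coeff R 1 = (\<Sum>i<s. if i = 0 then 1 else 0)"
      unfolding R_def coeff_sum using m(1) by (intro sum.cong) auto
    then have "coeff R 1 = 1" using s1 by simp
    then show "R \<noteq> 0" by auto
  qed
  also have "\<dots> \<le> 2 ^ (m * (s - 1))" unfolding R_def
    by (intro degree_sum_le order.trans[OF degree_monom_le] power_increasing mult_le_mono2) auto
  finally have range: "card (range \<phi>) \<le> 2 ^ (m * (s - 1))" .
  have "2 ^ l = card (range \<phi>) * card E"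
    using card_subspace_image_kernel[of UNIV \<phi>] \<phi>_add by (simp add: subspace2_iff card_UNIV E_eq)
  also have "\<dots> \<le> 2 ^ (m * (s - 1)) * card E" using range by (rule mult_right_mono) simp
  also have "(2::nat) ^ l = 2 ^ (m * (s - 1)) * 2 ^ m"
    using s1 unfolding s power_add[symmetric] by (cases s) (simp_all add: add.commute)
  finally have ge: "2 ^ m \<le> card E" by simp
  \<comment> \<open>The opposite inequality: \<open>E\<close> is the root set of a polynomial of
    degree at most 2^m. It is nonzero because 2^m and 1 differ, so the two monomials do not
    cancel.\<close>
  define p :: "'a poly" where "p = monom 1 (2 ^ m) + monom 1 1"
  have "(1::nat) \<noteq> 2 ^ m" using m(1) by (cases m) auto
  then have "coeff p (2 ^ m) = 1"
    by (simp only: p_def coeff_add coeff_monom if_True if_False simp_thms add_0_right)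
  then have "p \<noteq> 0" by auto
  then have "card {x. poly p x = 0} \<le> degree p" by (rule card_poly_roots_bound)
  also have "degree p \<le> 2 ^ m" unfolding p_def
    by (intro degree_add_le order.trans[OF degree_monom_le]) auto
  also have "{x. poly p x = 0} = E" by (simp add: p_def poly_monom E_eq \<phi>_def)
  finally have "card E = 2 ^ m" using ge by simp
  moreover have "is_subfield E"
    by (auto simp: is_subfield_def E_def frob_add power_mult_distrib power_inverse power_0_left)
  ultimately show ?thesis using that by blast
qed

text \<open>Additive form of Hilbert 90. The range lies in the trace kernel, and both have 2^(l-1)
  elements since x + x^2 vanishes only at 0 and 1.\<close>

lemma range_square_plus: "range (\<lambda>x::'a. x + x\<^sup>2) = {x. tr x = 0}"
proof (rule card_subset_eq)
  have U: "subspace_over prime_field2 (UNIV :: 'a set)" by (simp add: subspace2_iff)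
  show "range (\<lambda>x. x + x\<^sup>2) \<subseteq> {x. tr x = 0}" by (auto simp: tr_add tr_square)
  obtain z where "tr z = 1" by (rule tr_nonzero)
  then have "tr z \<noteq> 0" by simp
  then have "\<not> (\<forall>x\<in>UNIV. tr x = 0)" by blast
  then have "2 * card {x. tr x = 0} = 2 ^ l"
    using card_kernel_half[OF U, of tr] tr_add tr_in card_UNIV by (simp split: if_splits)
  moreover have "{x::'a. x + x\<^sup>2 = 0} = {0, 1}"
    by (auto simp: add_eq_0_iff_eq power2_eq_square)
  then have "2 ^ l = card (range (\<lambda>x::'a. x + x\<^sup>2)) * 2"
    using card_subspace_image_kernel[OF U, of "\<lambda>x. x + x\<^sup>2"] card_UNIV
    by (simp add: square_add ac_simps)
  ultimately show "card (range (\<lambda>x::'a. x + x\<^sup>2)) = card {x. tr x = 0}" by simp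
qed simp

text \<open>The tower argument: each block sums to an element of \<open>E\<close>, which is 0 by
  independence of \<open>lam\<close> over \<open>E\<close>; independence of \<open>\<gamma>\<close>
  then kills the coefficients in the block.\<close>

lemma product_family_indep:
  fixes \<gamma> lam :: "nat \<Rightarrow> 'a"
  assumes E: "is_subfield E" and \<gamma>: "lin_indep_over prime_field2 m \<gamma>" "\<And>j. j \<in> {1..m} \<Longrightarrow> \<gamma> j \<in> E"
    and lam: "lin_indep_over E n lam" and m: "m \<ge> 1"
    and \<gamma>': "\<And>i j. i \<in> {1..n} \<Longrightarrow> j \<in> {1..m} \<Longrightarrow> \<gamma>' ((i - 1) * m + j) = lam i * \<gamma> j"
  shows "lin_indep_over prime_field2 (n * m) \<gamma>'"
  unfolding lin_indep_over_def
proof (intro allI impI ballI)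
  fix c t assume c: "\<forall>t\<in>{1..n * m}. c t \<in> prime_field2" and s: "(\<Sum>t=1..n * m. c t * \<gamma>' t) = 0"
    and t: "t \<in> {1..n * m}"
  have idx: "(i - 1) * m + j \<in> {1..n * m}" if "i \<in> {1..n}" "j \<in> {1..m}" for i j
  proof -
    have "(i - 1) * m + m = i * m" using that by (simp add: diff_mult_distrib)
    also have "\<dots> \<le> n * m" using that by simp
    finally show ?thesis using that by simp
  qed
  define e where "e i = (\<Sum>j=1..m. c ((i - 1) * m + j) * \<gamma> j)" for i
  have "subspace_over prime_field2 E" using E by (simp add: subspace2_iff is_subfield_def)
  then have eE: "e i \<in> E" if "i \<in> {1..n}" for i
    unfolding e_def by (rule subspace_over_sum) (use that c idx \<gamma>(2) in auto)
  have "0 = (\<Sum>i=1..n. \<Sum>j=1..m. c ((i - 1) * m + j) * \<gamma>' ((i - 1) * m + j))"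
    using s unfolding sum_blocks by simp
  also have "\<dots> = (\<Sum>i=1..n. e i * lam i)"
    unfolding e_def sum_distrib_right
  proof (intro sum.cong refl)
    fix i j assume "i \<in> {1..n}" "j \<in> {1..m}"
    from \<gamma>'[OF this]
    show "c ((i - 1) * m + j) * \<gamma>' ((i - 1) * m + j) = c ((i - 1) * m + j) * \<gamma> j * lam i"
      by (simp only: ac_simps)
  qed
  finally have "\<forall>i\<in>{1..n}. e i = 0"
    using lam eE unfolding lin_indep_over_def by auto
  then have c0: "c ((i - 1) * m + j) = 0" if "i \<in> {1..n}" "j \<in> {1..m}" for i j
  proof -
    have "(\<Sum>j=1..m. c ((i - 1) * m + j) * \<gamma> j) = 0"
      using \<open>\<forall>i\<in>{1..n}. e i = 0\<close> that(1) by (simp add: e_def)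
    moreover have "\<forall>j\<in>{1..m}. c ((i - 1) * m + j) \<in> prime_field2" using c idx that(1) by blast
    ultimately have "\<forall>j\<in>{1..m}. c ((i - 1) * m + j) = 0"
      using \<gamma>(1)[unfolded lin_indep_over_def, THEN spec, of "\<lambda>j. c ((i - 1) * m + j)"] by blast
    then show ?thesis using that(2) by blast
  qed
  \<comment> \<open>Indices start at 1, so block and position of t come from dividing t - 1 by
    m.\<close>
  have "t - 1 < n * m" using t by auto
  then have "(t - 1) div m < n" by (rule less_mult_imp_div_less)
  moreover have "(t - 1) mod m < m" using m by simp
  moreover have "t = (Suc ((t - 1) div m) - 1) * m + Suc ((t - 1) mod m)" using t by simp
  ultimately show "c t = 0" using c0[of "Suc ((t - 1) div m)" "Suc ((t - 1) mod m)"] by simp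
qed

text \<open>Shows that the admissible choices are not vacuous.\<close>

lemma construction_exists:
  assumes m: "m = l - d + 2" "m dvd l"
  shows "\<exists>(E :: 'a set) \<gamma> lam \<beta> \<theta>0 \<theta>1. construction_data l d E \<gamma> lam \<beta> \<theta>0 \<theta>1"
proof -
  have m1: "m \<ge> 1" and ml: "2 \<le> l" using m l_pos dvd_imp_le[of m l] by auto
  obtain E :: "'a set" where E: "is_subfield E" "card E = 2 ^ m"
    using subfield_exists[OF m1 m(2)] by blast
  have E1: "1 \<in> E" using E(1) by (simp add: is_subfield_def)
  have Es: "subspace_over prime_field2 E" using E(1) by (simp add: subspace2_iff is_subfield_def)
  obtain n \<gamma>0 where \<gamma>0: "\<gamma>0 1 = 1" "basis_over prime_field2 E n \<gamma>0"
    using basis_over_exists[OF is_subfield_prime_field2 finite Es finite E1 one_neq_zero] by metis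
  have "card E = 2 ^ n"
    using card_span_over[OF is_subfield_prime_field2, of n \<gamma>0] \<gamma>0(2)
    by (simp add: basis_over_def card_prime_field2)
  then have n: "n = m" using E(2) by simp
  have "subspace_over E (UNIV :: 'a set)" by (simp add: subspace_over_def)
  then obtain s lam where lam: "lam 1 = 1" "basis_over E UNIV s lam"
    using basis_over_exists[OF E(1) finite _ finite UNIV_I one_neq_zero] by metis
  have "2 ^ l = (2::nat) ^ (m * s)"
    using card_span_over[OF E(1), of s lam] lam(2) by (simp add: basis_over_def E(2) card_UNIV power_mult)
  then have ls: "l = m * s" by simp
  then have s: "s = l div m" using m1 by simp
  define \<gamma> where "\<gamma> t = lam ((t - 1) div m + 1) * \<gamma>0 ((t - 1) mod m + 1)" for t
  have \<gamma>: "\<gamma> ((i - 1) * m + j) = lam i * \<gamma>0 j" if "i \<in> {1..s}" "j \<in> {1..m}" for i j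
  proof -
    have "(i - 1) * m + j - 1 = (i - 1) * m + (j - 1)" "j - 1 < m" using that by auto
    then have "((i - 1) * m + j - 1) div m = i - 1" "((i - 1) * m + j - 1) mod m = j - 1" by simp_all
    then show ?thesis using that by (simp add: \<gamma>_def)
  qed
  have s1: "1 \<in> {1..s}" using ls l_pos by (cases s) auto
  have \<gamma>\<gamma>0: "\<gamma> j = \<gamma>0 j" if "j \<in> {1..m}" for j using \<gamma>[OF s1 that] lam(1) by simp
  have \<gamma>0E: "\<gamma>0 j \<in> E" if "j \<in> {1..m}" for j
    using basis_over_mem[OF is_subfield_prime_field2 \<gamma>0(2)] that n by simp
  have "lin_indep_over prime_field2 (s * m) \<gamma>"
    by (rule product_family_indep[where E = E and \<gamma> = \<gamma>0 and lam = lam])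
      (use E(1) \<gamma>0E m1 \<gamma> \<gamma>0(2) n lam(2) in \<open>simp_all add: basis_over_def\<close>)
  then have "lin_indep_over prime_field2 l \<gamma>" using ls by (simp add: mult.commute)
  then obtain \<beta> where \<beta>: "\<forall>i\<in>{1..l}. \<forall>j\<in>{1..l}. tr (\<beta> i * \<gamma> j) = (if i = j then 1 else 0)"
    by (rule dual_family_exists)
  have "tr (\<beta> 2 * \<gamma> 2) = 1" using \<beta> ml by simp
  then have \<beta>2: "\<beta> 2 \<noteq> 0" by auto
  \<comment> \<open>With both coefficients equal to the inverse of \<open>\<beta> 2\<close>, L is
    that inverse times x + x^2, and the latter ranges over the trace kernel.\<close>
  define \<theta> where "\<theta> = inverse (\<beta> 2)"
  have "poly (constr_L \<theta> \<theta>) x = \<theta> * (x + x\<^sup>2)" for x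
    by (simp add: constr_L_def algebra_simps power2_eq_square)
  then have "range (poly (constr_L \<theta> \<theta>)) = (\<lambda>y. \<theta> * y) ` range (\<lambda>x. x + x\<^sup>2)"
    by (simp add: image_image)
  then have "range (poly (constr_L \<theta> \<theta>)) = scaled_trace_ker l (\<beta> 2)"
    by (simp add: range_square_plus scaled_trace_ker_def \<theta>_def)
  moreover have "basis_over prime_field2 E m \<gamma>"
    using \<gamma>0(2) n basis_over_cong[of m \<gamma> \<gamma>0 prime_field2 E] \<gamma>\<gamma>0 by simp
  moreover have "\<gamma> 1 = 1" using \<gamma>\<gamma>0[of 1] \<gamma>0(1) m1 by simp
  ultimately have "construction_data l d E \<gamma> lam \<beta> \<theta> \<theta>"
    using E lam \<beta> \<gamma> \<gamma>\<gamma>0 \<beta>2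
    unfolding construction_data_def Let_def m(1)[symmetric] s[symmetric]
    by (auto simp: \<theta>_def)
  then show ?thesis by blast
qed

end

section \<open>The I/O cost of the construction\<close>

locale io_construction = binary_field F l for F :: "'a::{field,finite} itself" and l +
  fixes d m :: nat and E :: "'a set" and \<gamma> lam \<beta> :: "nat \<Rightarrow> 'a" and \<theta>0 \<theta>1 :: 'a
  assumes data: "construction_data l d E \<gamma> lam \<beta> \<theta>0 \<theta>1"
    and d_less: "d < l" and m_dvd: "m dvd l" and m_def: "m = l - d + 2"
begin

text \<open>Divisibility gives m <= l, which amounts to d >= 2; d < l gives m >= 3.\<close>

lemma m_bounds: "3 \<le> m" "m \<le> l" "2 \<le> d"
  using d_less m_def m_dvd dvd_imp_le[of m l] by auto

lemma
  shows E: "is_subfield E"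
    and \<gamma>_basis: "basis_over prime_field2 E m \<gamma>" and \<gamma>1: "\<gamma> 1 = 1"
    and lam_basis: "basis_over E UNIV (l div m) lam" and lam1: "lam 1 = 1"
    and \<gamma>_prod: "\<And>i j. i \<in> {1..l div m} \<Longrightarrow> j \<in> {1..m} \<Longrightarrow> \<gamma> ((i - 1) * m + j) = lam i * \<gamma> j"
    and dual: "\<And>i j. i \<in> {1..l} \<Longrightarrow> j \<in> {1..l} \<Longrightarrow> tr (\<beta> i * \<gamma> j) = (if i = j then 1 else 0)"
    and range_L: "range (poly (constr_L \<theta>0 \<theta>1)) = scaled_trace_ker l (\<beta> 2)"
  using data unfolding construction_data_def Let_def m_def[symmetric] by blast+

abbreviation "L \<equiv> poly (constr_L \<theta>0 \<theta>1)"
abbreviation "W \<equiv> constr_W l d \<beta>"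
abbreviation "A \<equiv> constr_A l d \<beta> \<theta>0 \<theta>1"
abbreviation "g \<equiv> constr_g l d \<gamma> \<theta>0 \<theta>1"

lemma \<gamma>_indep: "lin_indep_over prime_field2 l \<gamma>"
  using dual by (intro dual_family_indep[of l \<beta>]) blast

lemma \<beta>_indep: "lin_indep_over prime_field2 l \<beta>"
  using dual by (intro dual_family_indep[of l \<gamma>]) (auto simp: mult.commute)

lemma L_eq: "L x = \<theta>0 * x + \<theta>1 * x\<^sup>2"
  by (simp add: constr_L_def algebra_simps power2_eq_square)

lemma L_add: "L (x + y) = L x + L y"
  by (simp add: L_eq square_add algebra_simps)

lemma W_iff: "y \<in> W \<longleftrightarrow> (\<forall>i\<in>{2..m}. tr (\<beta> i * y) = 0)"
proof -
  have "scaled_trace_ker l (\<beta> i) = {y. tr (\<beta> i * y) = 0}" if "i \<in> {2..m}" for i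
    using that m_bounds by (intro scaled_trace_ker_eq basis2_nonzero[OF \<beta>_indep]) auto
  then show ?thesis unfolding constr_W_def m_def[symmetric] by simp
qed

lemma card_W: "card W = 2 ^ (d - 1)"
proof -
  have "W = {y. \<forall>i\<in>{2..m}. tr (y * \<beta> i) = 0}" by (auto simp: W_iff mult.commute)
  then have "card W = 2 ^ (l - card {2..m})"
    using card_trace_annihilator[OF \<beta>_indep, of "{2..m}"] m_bounds by auto
  moreover have "l - card {2..m} = d - 1" using m_bounds d_less by (simp add: m_def)
  ultimately show ?thesis by simp
qed

lemma range_L_eq: "range L = {y. tr (y * \<beta> 2) = 0}"
  unfolding range_L using m_bounds basis2_nonzero[OF \<beta>_indep, of 2]
  by (subst scaled_trace_ker_eq) (auto simp: mult.commute)

lemma A_iff: "x \<in> A \<longleftrightarrow> L x \<in> W"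
  by (simp add: constr_A_def)

lemma subspace_A: "subspace_over prime_field2 A"
  by (auto simp: subspace2_iff A_iff W_iff L_add distrib_left tr_add L_eq[of 0])

text \<open>\<open>W\<close> lies in the range of \<open>L\<close> because that range is cut out by
  the condition for \<open>\<beta> 2\<close>, one of those defining \<open>W\<close>.\<close>

lemma L_image_A: "L ` A = W"
proof (intro equalityI subsetI)
  fix y assume y: "y \<in> W"
  then have "y \<in> range L" unfolding range_L_eq using m_bounds by (auto simp: W_iff mult.commute)
  then show "y \<in> L ` A" using y by (auto simp: A_iff)
qed (auto simp: A_iff)

text \<open>The range of \<open>L\<close> is a hyperplane, so its kernel has two elements. The
  kernel lies in \<open>A\<close>, which therefore has twice as many elements as
  \<open>W\<close>.\<close>

lemma card_A: "card A = 2 ^ d"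
proof -
  have "card (UNIV :: 'a set) = card (range L) * card {x\<in>UNIV. L x = 0}"
    by (rule card_subspace_image_kernel) (simp_all add: subspace2_iff L_add del: poly_add)
  moreover have "card (range L) = 2 ^ (l - 1)"
    using card_trace_annihilator[OF \<beta>_indep, of "{2}"] m_bounds by (simp add: range_L_eq)
  moreover have "(2::nat) ^ l = 2 ^ (l - 1) * 2" using l_pos by (cases l) auto
  ultimately have ker: "card {x. L x = 0} = 2" by (simp add: card_UNIV)
  have "{x\<in>A. L x = 0} = {x. L x = 0}" by (auto simp: A_iff W_iff)
  then have "card A = 2 ^ (d - 1) * 2"
    using card_subspace_image_kernel[OF subspace_A L_add] by (simp add: L_image_A card_W ker)
  then show ?thesis using m_bounds by (cases d) auto
qed

lemma poly_g: "poly (g j) x = (if j \<le> m then \<gamma> j * (L x + 1) else \<gamma> j)"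
  unfolding constr_g_def m_def[symmetric] by (simp add: distrib_left)

lemma degree_g: "degree (g j) \<le> 2"
proof -
  have "degree (constr_L \<theta>0 \<theta>1) \<le> 2" by (simp add: constr_L_def)
  then show ?thesis unfolding constr_g_def
    by (auto intro!: degree_add_le order.trans[OF degree_smult_le])
qed

lemma scheme: "linear_repair_scheme l A (2 ^ d - 3) 0 g"
proof -
  \<comment> \<open>Since 2^d is at least 4, the natural number 2^d - 3 is an exact difference and
    at least 1.\<close>
  have "(2::nat) ^ 2 \<le> 2 ^ d" using m_bounds by (intro power_increasing) auto
  then have c: "(4::nat) \<le> 2 ^ d" by simp
  have "card A - (2 ^ d - 3) = 3" using c by (simp add: card_A)
  moreover have "degree (g j) < 3" for j using degree_g[of j] by simp
  moreover have "0 \<in> A" using subspace_A by (simp add: subspace2_iff)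
  moreover have "poly (g j) 0 = \<gamma> j" for j by (simp add: poly_g L_eq)
  ultimately show ?thesis using c \<gamma>_indep by (simp add: linear_repair_scheme_def card_A)
qed

text \<open>Expanding e in \<open>\<gamma>\<close> gives only basis vectors of blocks after the
  first, whose indices exceed m and hence \<open>\<nu>\<close>.\<close>

lemma tr_\<beta>_lam:
  assumes i: "i \<in> {2..l div m}" and e: "e \<in> E" and \<nu>: "\<nu> \<in> {1..m}"
  shows "tr (\<beta> \<nu> * (lam i * e)) = 0"
proof -
  obtain c where c: "\<forall>j\<in>{1..m}. c j \<in> prime_field2" "e = (\<Sum>j=1..m. c j * \<gamma> j)"
    using \<gamma>_basis e unfolding basis_over_def span_over_def by blast
  have idx: "(i - 1) * m + j \<in> {1..l}" "(i - 1) * m + j \<noteq> \<nu>" if "j \<in> {1..m}" for j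
  proof -
    have "(i - 1) * m + m = i * m" using i by (simp add: diff_mult_distrib)
    also have "\<dots> \<le> (l div m) * m" using i by (intro mult_le_mono1) auto
    also have "\<dots> = l" using m_dvd by simp
    finally show "(i - 1) * m + j \<in> {1..l}" using that by simp
    have "1 * m \<le> (i - 1) * m" using i by (intro mult_le_mono1) auto
    then have "\<nu> < (i - 1) * m + j" using that \<nu> unfolding atLeastAtMost_iff by linarith
    then show "(i - 1) * m + j \<noteq> \<nu>" by simp
  qed
  have "tr (\<beta> \<nu> * (lam i * e)) = (\<Sum>j=1..m. tr (c j * (\<beta> \<nu> * (lam i * \<gamma> j))))"
    unfolding c(2) sum_distrib_left tr_sum by (simp only: ac_simps)
  also have "\<dots> = (\<Sum>j=1..m. 0)"
  proof (intro sum.cong refl)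
    fix j assume j: "j \<in> {1..m}"
    have "tr (\<beta> \<nu> * \<gamma> ((i - 1) * m + j)) = 0"
      using dual[of \<nu> "(i - 1) * m + j"] idx[OF j] \<nu> m_bounds by auto
    moreover have "\<gamma> ((i - 1) * m + j) = lam i * \<gamma> j" using \<gamma>_prod[of i j] i j by simp
    ultimately show "tr (c j * (\<beta> \<nu> * (lam i * \<gamma> j))) = 0" using c(1) j by (simp add: tr_scale)
  qed
  finally show ?thesis by simp
qed

lemma \<gamma>_in_E: "j \<in> {1..m} \<Longrightarrow> \<gamma> j \<in> E"
  by (rule basis_over_mem[OF is_subfield_prime_field2 \<gamma>_basis])

text \<open>On \<open>W\<close>, the contribution of \<open>L\<close> to the upper left block is a
  scalar matrix: only the coordinate of w at \<open>lam 1\<close> is visible, and it lies in the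
  prime field.\<close>

lemma tr_W:
  assumes w: "w \<in> W" and j: "j \<in> {1..m}" and \<nu>: "\<nu> \<in> {1..m}"
  shows "tr (\<gamma> j * w * \<beta> \<nu>) = (if j = \<nu> then tr (\<beta> 1 * w) else 0)"
proof -
  let ?s = "l div m"
  obtain e where e: "\<forall>i\<in>{1..?s}. e i \<in> E" "w = (\<Sum>i=1..?s. e i * lam i)"
    using lam_basis unfolding basis_over_def span_over_def by blast
  have s1: "1 \<le> ?s" using m_bounds by (simp add: Suc_le_eq div_greater_zero_iff)
  have split: "x * w = x * e 1 + (\<Sum>i=2..?s. lam i * (x * e i))" for x
    unfolding e(2) sum_distrib_left sum.atLeast_Suc_atMost[OF s1] lam1
    by (simp add: distrib_left sum_distrib_left ac_simps numeral_2_eq_2)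
  \<comment> \<open>Multiplication by an element of \<open>E\<close> keeps the higher blocks apart
    from the first, so the first m dual vectors see only \<open>e 1\<close>.\<close>
  have first: "tr (\<beta> \<nu> * (x * w)) = tr (\<beta> \<nu> * (x * e 1))" if "x \<in> E" "\<nu> \<in> {1..m}" for x \<nu>
  proof -
    have "tr (\<beta> \<nu> * (\<Sum>i=2..?s. lam i * (x * e i))) = 0"
      unfolding sum_distrib_left tr_sum
      by (intro sum.neutral ballI tr_\<beta>_lam) (use e that E in \<open>auto simp: is_subfield_def\<close>)
    then show ?thesis unfolding split by (simp add: distrib_left tr_add)
  qed
  have "e 1 \<in> E" using e(1) s1 by simp
  then obtain c where c: "\<forall>k\<in>{1..m}. c k \<in> prime_field2" "e 1 = (\<Sum>k=1..m. c k * \<gamma> k)"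
    using \<gamma>_basis unfolding basis_over_def span_over_def by blast
  have E1: "1 \<in> E" using E by (simp add: is_subfield_def)
  have coord: "tr (\<beta> \<nu> * w) = c \<nu>" if \<nu>: "\<nu> \<in> {1..m}" for \<nu>
  proof -
    have "tr (\<beta> \<nu> * w) = tr (\<beta> \<nu> * e 1)" using first[OF E1 \<nu>] by simp
    also have "\<dots> = (\<Sum>k=1..m. tr (c k * (\<beta> \<nu> * \<gamma> k)))"
      unfolding c(2) sum_distrib_left tr_sum by (simp only: ac_simps)
    also have "\<dots> = (\<Sum>k=1..m. if \<nu> = k then c k else 0)"
      using c(1) dual \<nu> m_bounds by (intro sum.cong) (auto simp: tr_scale)
    finally show ?thesis using \<nu> by simp
  qed
  \<comment> \<open>Membership in \<open>W\<close> kills the coordinates 2 to m of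
    \<open>e 1\<close>; what remains is a multiple of \<open>\<gamma> 1 = 1\<close>, a scalar that
    can be pulled out of the trace.\<close>
  have "e 1 = (\<Sum>k=1..m. if k = 1 then c 1 else 0)"
    unfolding c(2)
  proof (intro sum.cong refl)
    fix k assume k: "k \<in> {1..m}"
    show "c k * \<gamma> k = (if k = 1 then c 1 else 0)"
      using coord[OF k] w k \<gamma>1 by (auto simp: W_iff)
  qed
  then have e1: "e 1 = tr (\<beta> 1 * w)" using coord[of 1] m_bounds by simp
  have "tr (\<gamma> j * w * \<beta> \<nu>) = tr (e 1 * (\<beta> \<nu> * \<gamma> j))"
    using first[OF \<gamma>_in_E[OF j] \<nu>] by (simp only: ac_simps)
  also have "\<dots> = e 1 * tr (\<beta> \<nu> * \<gamma> j)" using e1 tr_in by (simp add: tr_scale)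
  finally show ?thesis using dual[of \<nu> j] j \<nu> m_bounds e1 by auto
qed

lemma zero_column_iff:
  assumes x: "x \<in> A" and \<nu>: "\<nu> \<in> {1..l}"
  shows "(\<forall>j\<in>{1..l}. tr (poly (g j) x * \<beta> \<nu>) = 0) \<longleftrightarrow> \<nu> \<le> m \<and> tr (\<beta> 1 * L x) = 1"
proof -
  \<comment> \<open>For \<open>\<nu>\<close> beyond m the diagonal entry is 1 and already makes the
    column nonzero, so all rows are evaluated only when \<open>\<nu> \<le> m\<close>.\<close>
  have val: "tr (poly (g j) x * \<beta> \<nu>) =
      (if j = \<nu> then if \<nu> \<le> m then tr (\<beta> 1 * L x) + 1 else 1 else 0)"
    if j: "j \<in> {1..l}" and "\<nu> \<le> m \<or> j = \<nu>" for j
  proof (cases "j \<le> m")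
    case True
    have "tr (\<gamma> j * \<beta> \<nu>) = (if j = \<nu> then 1 else 0)" using dual[OF \<nu> j] by (auto simp: mult.commute)
    moreover have "tr (\<gamma> j * L x * \<beta> \<nu>) = (if j = \<nu> then tr (\<beta> 1 * L x) else 0)"
      using tr_W[of "L x" j \<nu>] x j \<nu> True that(2) by (auto simp: A_iff)
    ultimately show ?thesis using True that(2)
      by (simp add: poly_g distrib_left distrib_right tr_add)
  next
    case False
    then show ?thesis using dual[OF \<nu> j] that(2) by (auto simp: poly_g mult.commute)
  qed
  show ?thesis
  proof (cases "\<nu> \<le> m")
    case True
    then have "(\<forall>j\<in>{1..l}. tr (poly (g j) x * \<beta> \<nu>) = 0) \<longleftrightarrow> tr (\<beta> 1 * L x) + 1 = 0"
      using val \<nu> by auto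
    then show ?thesis using True by (simp add: add_eq_0_iff_eq)
  next
    case False
    then have "tr (poly (g \<nu>) x * \<beta> \<nu>) \<noteq> 0" using val[OF \<nu>] by simp
    then show ?thesis using False \<nu> by blast
  qed
qed

text \<open>The functional is nonzero on \<open>A\<close>: by duality 1 = \<open>\<gamma> 1\<close>
  lies in \<open>W\<close>, it is attained by \<open>L\<close> on \<open>A\<close>, and its pairing
  with \<open>\<beta> 1\<close> is 1.\<close>

lemma card_zero_nodes: "card {x\<in>A. tr (\<beta> 1 * L x) = 1} = 2 ^ (d - 1)"
proof -
  have "1 \<in> W" unfolding W_iff
  proof
    fix i assume "i \<in> {2..m}"
    then show "tr (\<beta> i * 1) = 0" using dual[of i 1] m_bounds \<gamma>1 by simp
  qed
  then obtain x1 where "x1 \<in> A" "L x1 = 1" using L_image_A by (metis imageE)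
  moreover have "tr (\<beta> 1 * 1) = 1" using dual[of 1 1] m_bounds \<gamma>1 by simp
  ultimately have "x1 \<in> A" "tr (\<beta> 1 * L x1) \<noteq> 0" by simp_all
  then have nz: "\<not> (\<forall>x\<in>A. tr (\<beta> 1 * L x) = 0)" by blast
  have "2 * card {x\<in>A. tr (\<beta> 1 * L x) = 0} = card A"
    using card_kernel_half[OF subspace_A, of "\<lambda>x. tr (\<beta> 1 * L x)"] unfolding if_not_P[OF nz]
    by (simp add: L_add distrib_left tr_add tr_in)
  moreover have "{x\<in>A. tr (\<beta> 1 * L x) = 1} = A - {x\<in>A. tr (\<beta> 1 * L x) = 0}"
    using tr_cases by auto
  then have "card {x\<in>A. tr (\<beta> 1 * L x) = 1} = card A - card {x\<in>A. tr (\<beta> 1 * L x) = 0}"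
    by (simp add: card_Diff_subset)
  moreover have "(2::nat) ^ d = 2 * 2 ^ (d - 1)" using m_bounds by (cases d) auto
  ultimately show ?thesis by (simp add: card_A)
qed

lemma scheme_zero_columns:
  "(\<Sum>\<nu>=1..l. card {x\<in>A - {0}. \<forall>j\<in>{1..l}. tr (poly (g j) x * \<beta> \<nu>) = 0}) = m * 2 ^ (d - 1)"
proof -
  have "(\<Sum>\<nu>=1..l. card {x\<in>A - {0}. \<forall>j\<in>{1..l}. tr (poly (g j) x * \<beta> \<nu>) = 0}) =
      (\<Sum>\<nu>=1..l. if \<nu> \<in> {1..m} then 2 ^ (d - 1) else 0)"
  proof (intro sum.cong refl)
    fix \<nu> assume \<nu>: "\<nu> \<in> {1..l}"
    have "{x\<in>A - {0}. \<forall>j\<in>{1..l}. tr (poly (g j) x * \<beta> \<nu>) = 0} =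
        {x\<in>A - {0}. \<nu> \<le> m \<and> tr (\<beta> 1 * L x) = 1}"
      using zero_column_iff[OF _ \<nu>] by blast
    \<comment> \<open>The failed node 0 is not among the counted points, because L(0) = 0 has trace
      0.\<close>
    also have "\<dots> = (if \<nu> \<in> {1..m} then {x\<in>A. tr (\<beta> 1 * L x) = 1} else {})"
      using \<nu> by (auto simp: L_eq)
    finally show "card {x\<in>A - {0}. \<forall>j\<in>{1..l}. tr (poly (g j) x * \<beta> \<nu>) = 0} =
        (if \<nu> \<in> {1..m} then 2 ^ (d - 1) else 0)"
      using card_zero_nodes by simp
  qed
  also have "\<dots> = (\<Sum>\<nu>=1..m. 2 ^ (d - 1))"
    using m_bounds by (intro sum.mono_neutral_cong_right) auto
  finally show ?thesis by simp
qed

lemma io_cost_scheme: "io_cost l A 0 g \<beta> + m * 2 ^ (d - 1) = (2 ^ d - 1) * l"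
  using io_cost_complement[of A 0 l g \<beta>] subspace_A
  unfolding scheme_zero_columns card_A by (simp add: subspace2_iff)

text \<open>Both costs complete a number of vanishing columns to the same total (2^d - 1) l, and the
  construction attains the upper bound on that number.\<close>

lemma io_cost_optimal:
  assumes g': "linear_repair_scheme l A (2 ^ d - 3) a g'" and \<beta>': "basis_over prime_field2 UNIV l \<beta>'"
  shows "io_cost l A 0 g \<beta> \<le> io_cost l A a g' \<beta>'"
proof -
  have a: "a \<in> A" and ind: "lin_indep_over prime_field2 l (\<lambda>j. poly (g' j) a)"
    using g' by (auto simp: linear_repair_scheme_def)
  have deg: "degree (g' j) \<le> 2" if "j \<in> {1..l}" for j
  proof -
    have "degree (g' j) < card A - (2 ^ d - 3)"
      using g' that unfolding linear_repair_scheme_def by blast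
    then show ?thesis by (simp add: card_A)
  qed
  have "(\<Sum>\<nu>=1..l. card {x\<in>A - {a}. \<forall>j\<in>{1..l}. tr (poly (g' j) x * \<beta>' \<nu>) = 0}) \<le> m * 2 ^ (d - 1)"
    unfolding m_def using d_less \<beta>'
    by (intro scheme_zero_count[OF subspace_A card_A _ a deg ind]) (auto simp: basis_over_def)
  then show ?thesis
    using io_cost_complement[OF finite a, of l g' \<beta>'] io_cost_scheme by (simp add: card_A)
qed

end

theorem corollary24:
  fixes l d :: nat
  assumes card_F: "card (UNIV :: 'a::{field,finite} set) = 2 ^ l"
    and "l > 1" and "d < l" and "(l - d + 2) dvd l"
  shows "(\<exists>(E :: 'a set) \<gamma> lam \<beta> \<theta>0 \<theta>1. construction_data l d E \<gamma> lam \<beta> \<theta>0 \<theta>1) \<and>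
    (\<forall>(E :: 'a set) \<gamma> lam \<beta> \<theta>0 \<theta>1. construction_data l d E \<gamma> lam \<beta> \<theta>0 \<theta>1 \<longrightarrow>
      (let A = constr_A l d \<beta> \<theta>0 \<theta>1; g = constr_g l d \<gamma> \<theta>0 \<theta>1; n = 2 ^ d; k = 2 ^ d - 3 in
        subspace_of_dim prime_field2 A d \<and> card A = n \<and>
        basis_over prime_field2 UNIV l \<beta> \<and>
        linear_repair_scheme l A k 0 g \<and>
        int (io_cost l A 0 g \<beta>) =
          (int n - 1) * int l - (int l - int d + 2) * 2 ^ (d - 1) \<and>
        (\<forall>a g' \<beta>'. linear_repair_scheme l A k a g' \<and> basis_over prime_field2 UNIV l \<beta>' \<longrightarrow>
           io_cost l A 0 g \<beta> \<le> io_cost l A a g' \<beta>')))"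
proof (intro conjI allI impI)
  interpret binary_field "TYPE('a)" l
    using card_F \<open>l > 1\<close> by unfold_locales auto
  show "\<exists>(E :: 'a set) \<gamma> lam \<beta> \<theta>0 \<theta>1. construction_data l d E \<gamma> lam \<beta> \<theta>0 \<theta>1"
    using construction_exists[OF refl] assms(4) by blast
  fix E :: "'a set" and \<gamma> lam \<beta> \<theta>0 \<theta>1
  assume "construction_data l d E \<gamma> lam \<beta> \<theta>0 \<theta>1"
  then interpret io_construction "TYPE('a)" l d "l - d + 2" E \<gamma> lam \<beta> \<theta>0 \<theta>1
    using assms by unfold_locales auto
  \<comment> \<open>The additive identity is moved to the integers before subtracting; d < l makes l
    - d + 2 exact there.\<close>
  have "int (io_cost l A 0 g \<beta>) + int ((l - d + 2) * 2 ^ (d - 1)) = int ((2 ^ d - 1) * l)"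
    using io_cost_scheme by (simp flip: of_nat_add)
  moreover have "int ((l - d + 2) * 2 ^ (d - 1)) = (int l - int d + 2) * 2 ^ (d - 1)"
    using d_less by (simp add: of_nat_diff distrib_right)
  moreover have "int ((2 ^ d - 1) * l) = (int (2 ^ d) - 1) * int l"
    by (simp add: of_nat_diff)
  ultimately have cost: "int (io_cost l A 0 g \<beta>) =
      (int (2 ^ d) - 1) * int l - (int l - int d + 2) * 2 ^ (d - 1)"
    by linarith
  have "subspace_of_dim prime_field2 A d"
    using subspace_A card_A m_bounds by (intro subspace_of_dimI) auto
  then show "let A = constr_A l d \<beta> \<theta>0 \<theta>1; g = constr_g l d \<gamma> \<theta>0 \<theta>1; n = 2 ^ d; k = 2 ^ d - 3 in
        subspace_of_dim prime_field2 A d \<and> card A = n \<and>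
        basis_over prime_field2 UNIV l \<beta> \<and>
        linear_repair_scheme l A k 0 g \<and>
        int (io_cost l A 0 g \<beta>) =
          (int n - 1) * int l - (int l - int d + 2) * 2 ^ (d - 1) \<and>
        (\<forall>a g' \<beta>'. linear_repair_scheme l A k a g' \<and> basis_over prime_field2 UNIV l \<beta>' \<longrightarrow>
           io_cost l A 0 g \<beta> \<le> io_cost l A a g' \<beta>')"
    unfolding Let_def using card_A basis2I[OF \<beta>_indep] scheme cost io_cost_optimal by blast
qed

end
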